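(* Let $G$ be a cyclically $4$-edge-connected cubic graph of order $n$. Then $V(G)$ has a partition $\{A,J\}$ such that $G[A]$ is a tree and $J$ is independent or near-independent; moreover, $J$ is independent if and only if $n\equiv 2\pmod 4$.
   Context: Graphs are finite; loops and multiple edges are allowed; a cubic graph is $3$-regular. $G[X]$ denotes the subgraph induced by $X\subseteq V(G)$. A set $J$ of vertices is independent if $G[J]$ has no edges and near-independent if $G[J]$ has exactly one edge. A set $B\subseteq E(G)$ is cycle-separating if $G-B$ is disconnected and at least two of its components contain cycles. A connected graph $G$ is cyclically $k$-edge-connected if no set of fewer than $k$ edges is cycle-separating in $G$. *)

theory Defs
  imports Main
begin

(* A finite multigraph (loops and parallel edges allowed) is given by a vertex set V,
   an edge set E and an incidence map inc sending each edge to the set of its ends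
   (a singleton for a loop, a 2-set otherwise). *)

definition multigraph :: "'a set \<Rightarrow> 'e set \<Rightarrow> ('e \<Rightarrow> 'a set) \<Rightarrow> bool" where
  "multigraph V E inc \<longleftrightarrow> finite V \<and> finite E \<and>
     (\<forall>e\<in>E. inc e \<subseteq> V \<and> (card (inc e) = 1 \<or> card (inc e) = 2))"

definition degree :: "'e set \<Rightarrow> ('e \<Rightarrow> 'a set) \<Rightarrow> 'a \<Rightarrow> nat" where
  "degree E inc v = card {e\<in>E. v \<in> inc e \<and> card (inc e) = 2} + 2 * card {e\<in>E. inc e = {v}}"

definition cubic :: "'a set \<Rightarrow> 'e set \<Rightarrow> ('e \<Rightarrow> 'a set) \<Rightarrow> bool" where
  "cubic V E inc \<longleftrightarrow> multigraph V E inc \<and> (\<forall>v\<in>V. degree E inc v = 3)"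

inductive reach :: "'e set \<Rightarrow> ('e \<Rightarrow> 'a set) \<Rightarrow> 'a \<Rightarrow> 'a \<Rightarrow> bool"
  for F inc where
  refl: "reach F inc x x"
| step: "reach F inc x y \<Longrightarrow> e \<in> F \<Longrightarrow> inc e = {y, z} \<Longrightarrow> reach F inc x z"

definition connected_on :: "'a set \<Rightarrow> 'e set \<Rightarrow> ('e \<Rightarrow> 'a set) \<Rightarrow> bool" where
  "connected_on W F inc \<longleftrightarrow> W \<noteq> {} \<and> (\<forall>x\<in>W. \<forall>y\<in>W. reach F inc x y)"

(* a cycle with vertices in W and edges in F: distinct vertices v_0..v_{k-1},
   distinct edges e_0..e_{k-1}, k >= 1, e_i joins v_i and v_{i+1 mod k}
   (k = 1: a loop; k = 2: a pair of parallel edges) *)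
definition has_cycle :: "'a set \<Rightarrow> 'e set \<Rightarrow> ('e \<Rightarrow> 'a set) \<Rightarrow> bool" where
  "has_cycle W F inc \<longleftrightarrow> (\<exists>vs es. length vs = length es \<and> length es \<ge> 1 \<and>
     distinct vs \<and> distinct es \<and> set vs \<subseteq> W \<and> set es \<subseteq> F \<and>
     (\<forall>i < length es. inc (es ! i) = {vs ! i, vs ! ((i + 1) mod length es)}))"

definition induced_edges :: "'e set \<Rightarrow> ('e \<Rightarrow> 'a set) \<Rightarrow> 'a set \<Rightarrow> 'e set" where
  "induced_edges E inc X = {e\<in>E. inc e \<subseteq> X}"

definition is_tree :: "'a set \<Rightarrow> 'e set \<Rightarrow> ('e \<Rightarrow> 'a set) \<Rightarrow> bool" where
  "is_tree W F inc \<longleftrightarrow> connected_on W F inc \<and> \<not> has_cycle W F inc"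

definition independent :: "'e set \<Rightarrow> ('e \<Rightarrow> 'a set) \<Rightarrow> 'a set \<Rightarrow> bool" where
  "independent E inc J \<longleftrightarrow> induced_edges E inc J = {}"

definition near_independent :: "'e set \<Rightarrow> ('e \<Rightarrow> 'a set) \<Rightarrow> 'a set \<Rightarrow> bool" where
  "near_independent E inc J \<longleftrightarrow> card (induced_edges E inc J) = 1"

definition component :: "'a set \<Rightarrow> 'e set \<Rightarrow> ('e \<Rightarrow> 'a set) \<Rightarrow> 'a \<Rightarrow> 'a set" where
  "component V F inc x = {y\<in>V. reach F inc x y}"

definition cycle_separating :: "'a set \<Rightarrow> 'e set \<Rightarrow> ('e \<Rightarrow> 'a set) \<Rightarrow> 'e set \<Rightarrow> bool" where
  "cycle_separating V E inc B \<longleftrightarrow> B \<subseteq> E \<and>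
     \<not> connected_on V (E - B) inc \<and>
     (\<exists>x\<in>V. \<exists>y\<in>V. component V (E - B) inc x \<noteq> component V (E - B) inc y \<and>
        has_cycle (component V (E - B) inc x) (E - B) inc \<and>
        has_cycle (component V (E - B) inc y) (E - B) inc)"

definition cyclically_k_edge_connected :: "nat \<Rightarrow> 'a set \<Rightarrow> 'e set \<Rightarrow> ('e \<Rightarrow> 'a set) \<Rightarrow> bool" where
  "cyclically_k_edge_connected k V E inc \<longleftrightarrow> connected_on V E inc \<and>
     (\<forall>B. B \<subseteq> E \<and> card B < k \<longrightarrow> \<not> cycle_separating V E inc B)"

end

theory Submission
  imports Defs "HOL-Library.Disjoint_Sets"
begin

text \<open>
  Suppose the complement of a spanning tree \<open>T\<close> splits into pairs of edges with a common end,
  different pairs at different vertices. In a cubic graph the vertices carrying the pairs are leaves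
  of \<open>T\<close> and meet every cotree edge, so deleting them leaves an induced tree. By counting degrees,
  the deleted set \<open>J\<close> spans \<open>e\<close> edges where \<open>n + 2 + 2e = 4|J|\<close>, and so \<open>e\<close> is controlled by \<open>|J|\<close>.

  Such a tree exists if Nebesky's condition for upper embeddability holds: for every set \<open>F\<close> of edges,
  the number of components of \<open>G - F\<close> plus the number of those with odd cycle rank is at most
  \<open>|F| + 1\<close>. The condition is proved sufficient by induction, in the style of the proof of Tutte's
  1-factor theorem by maximal barriers.

  If \<open>n \<equiv> 2 (mod 4)\<close>, the whole graph satisfies the condition. If \<open>n \<equiv> 0 (mod 4)\<close>, the graph obtained by
  deleting two adjacent vertices \<open>u\<close> and \<open>v\<close> does, and \<open>uv\<close> becomes the single edge inside \<open>J\<close>. In both cases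
  every component containing a cycle is left by at least four edges, with one harmless exception,
  and every other component by at least three.
\<close>

section \<open>Reachability, trees and cycles\<close>

lemma reach_trans: "reach F inc x y \<Longrightarrow> reach F inc y z \<Longrightarrow> reach F inc x z"
  by (rotate_tac, induction rule: reach.induct) (auto intro: reach.step)

lemma reach_edge: "e \<in> F \<Longrightarrow> inc e = {x, y} \<Longrightarrow> reach F inc x y"
  by (meson reach.refl reach.step)

lemma reach_sym: "reach F inc x y \<Longrightarrow> reach F inc y x"
proof (induction rule: reach.induct)
  case (step x y e z)
  then have "reach F inc z y" by (intro reach_edge[of e]) auto
  with step show ?case by (blast intro: reach_trans)
qed (rule reach.refl)

lemma reach_mono: "reach F inc x y \<Longrightarrow> F \<subseteq> F' \<Longrightarrow> reach F' inc x y"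
  by (induction rule: reach.induct) (auto intro: reach.intros)

lemma reach_leaves_set:
  assumes "reach F inc x y" "x \<in> Y" "y \<notin> Y"
  shows "\<exists>e\<in>F. \<exists>a\<in>Y. \<exists>b. b \<notin> Y \<and> inc e = {a, b}"
  using assms by (induction rule: reach.induct) blast+

lemma reach_stays:
  assumes "reach F inc x y" "x \<in> Y" "\<And>e. e \<in> F \<Longrightarrow> inc e \<inter> Y = {} \<or> inc e \<subseteq> Y"
  shows "y \<in> Y"
  using reach_leaves_set[OF assms(1,2)] assms(3) by blast

lemma connected_onI_root:
  assumes "r \<in> W" "\<And>x. x \<in> W \<Longrightarrow> reach F inc r x"
  shows "connected_on W F inc"
  unfolding connected_on_def using assms by (blast intro: reach_trans reach_sym)

section \<open>Edge counts of connected and of acyclic graphs\<close>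

text \<open>Grow a set \<open>Y\<close> from a root: while \<open>Y\<close> is not all of
  \<open>X\<close>, connectivity supplies an edge leaving \<open>Y\<close>, and adding its far end
  brings one vertex and at least one inner edge. A maximal \<open>Y\<close> satisfying the bound is
  therefore \<open>X\<close>.\<close>

lemma connected_on_card_le:
  assumes "finite X" "finite T" "connected_on X T inc" "\<And>e. e \<in> T \<Longrightarrow> inc e \<subseteq> X"
  shows "card X \<le> card T + 1"
proof -
  obtain r where r: "r \<in> X" using assms(3) by (auto simp: connected_on_def)
  define S where "S = {Y. Y \<subseteq> X \<and> r \<in> Y \<and> card Y \<le> card (induced_edges T inc Y) + 1}"
  have "finite S" unfolding S_def using assms(1) by simp
  moreover have "{r} \<in> S" using r by (simp add: S_def)
  ultimately obtain Y where Y: "Y \<in> S" and max: "\<And>Z. Z \<in> S \<Longrightarrow> Y \<subseteq> Z \<Longrightarrow> Z = Y"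
    by (metis empty_iff finite_has_maximal)
  have fY: "finite Y" using Y assms(1) by (auto simp: S_def intro: finite_subset)
  have "Y = X"
  proof (rule ccontr)
    assume "Y \<noteq> X"
    with Y obtain y where y: "y \<in> X" "y \<notin> Y" by (auto simp: S_def)
    have "reach T inc r y" using assms(3) r y by (auto simp: connected_on_def)
    from reach_leaves_set[OF this, of Y] Y y(2) obtain e a b
      where e: "e \<in> T" "a \<in> Y" "b \<notin> Y" "inc e = {a, b}" by (auto simp: S_def)
    have "insert e (induced_edges T inc Y) \<subseteq> induced_edges T inc (insert b Y)"
      using e by (auto simp: induced_edges_def)
    then have "card (insert e (induced_edges T inc Y)) \<le> card (induced_edges T inc (insert b Y))"
      using assms(2) by (intro card_mono) (auto simp: induced_edges_def)
    moreover have "e \<notin> induced_edges T inc Y" using e by (auto simp: induced_edges_def)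
    ultimately have "insert b Y \<in> S"
      using Y e assms(2) assms(4)[of e] fY by (auto simp: S_def induced_edges_def)
    with max e show False by blast
  qed
  with Y assms(2) have "card X \<le> card (induced_edges T inc X) + 1" by (simp add: S_def)
  moreover have "card (induced_edges T inc X) \<le> card T"
    using assms(2) by (intro card_mono) (auto simp: induced_edges_def)
  ultimately show ?thesis by linarith
qed

text \<open>Without its first edge a cycle is still a path: from \<open>vs ! i\<close> the later
  edges lead forward around to \<open>vs ! 0\<close>. The induction is on the number of steps
  left.\<close>

lemma cycle_reach:
  assumes len: "length vs = length es" and dist: "distinct es" and sub: "set es \<subseteq> F"
    and edge: "\<forall>i < length es. inc (es ! i) = {vs ! i, vs ! ((i + 1) mod length es)}"
    and ne: "es \<noteq> []"
  shows "i < length es \<Longrightarrow> reach (F - {es ! 0}) inc (vs ! i) (vs ! 0)"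
proof (induction "length es - i" arbitrary: i)
  case (Suc k)
  show ?case
  proof (cases "i = 0")
    case False
    have "es ! i \<in> F - {es ! 0}" using Suc.prems False dist sub ne
      by (metis DiffI length_greater_0_conv nth_eq_iff_index_eq nth_mem singletonD subsetD)
    then have 1: "reach (F - {es ! 0}) inc (vs ! i) (vs ! ((i + 1) mod length es))"
      using edge Suc.prems by (intro reach_edge) auto
    show ?thesis
    proof (cases "i + 1 = length es")
      case True
      then show ?thesis using 1 by simp
    next
      case False
      then have "i + 1 < length es" using Suc.prems by simp
      with Suc.hyps(1)[of "i + 1"] Suc.hyps(2) 1 show ?thesis by (auto intro: reach_trans)
    qed
  qed (simp add: reach.refl)
qed simp

text \<open>An edge of a cycle can be bypassed along the rest of the cycle, so deleting it keeps the
  graph connected, with too few edges for \<open>connected_on_card_le\<close>.\<close>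

lemma tree_card_acyclic:
  assumes "finite X" "finite T" "connected_on X T inc" "\<And>e. e \<in> T \<Longrightarrow> inc e \<subseteq> X"
    and "card T + 1 = card X"
  shows "\<not> has_cycle X T inc"
proof
  assume "has_cycle X T inc"
  then obtain vs es where c: "length vs = length es" "length es \<ge> 1" "distinct es" "set es \<subseteq> T"
    "\<forall>i < length es. inc (es ! i) = {vs ! i, vs ! ((i + 1) mod length es)}"
    unfolding has_cycle_def by blast
  let ?e = "es ! 0"
  have eT: "?e \<in> T" using c(2,4) nth_mem[of 0 es] by (metis One_nat_def Suc_le_lessD subsetD)
  \<comment> \<open>The index is \<open>1 mod length es\<close> because a loop is a cycle of length
    1, with \<open>vs ! 0\<close> as its only end.\<close>
  have ends: "inc ?e = {vs ! 0, vs ! (1 mod length es)}"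
    using c(2) spec[OF c(5), of 0] by (cases es) (auto split: if_splits)
  have rest: "reach (T - {?e}) inc (vs ! (1 mod length es)) (vs ! 0)"
    using cycle_reach[OF c(1,3,4,5), of "1 mod length es"] c(2) by (cases es) auto
  have "reach (T - {?e}) inc x y" if "reach T inc x y" for x y
    using that
  proof (induction rule: reach.induct)
    case (step x y e z)
    have "reach (T - {?e}) inc y z"
    proof (cases "e = ?e")
      case True
      then have "{y, z} = {vs ! 0, vs ! (1 mod length es)}" using step ends by simp
      then show ?thesis using rest reach_sym[OF rest] reach.refl by (metis doubleton_eq_iff)
    next
      case False
      then show ?thesis using step by (intro reach_edge[of e]) auto
    qed
    with step show ?case by (blast intro: reach_trans)
  qed (rule reach.refl)
  then have "connected_on X (T - {?e}) inc" using assms(3) by (auto simp: connected_on_def)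
  then have "card X \<le> card (T - {?e}) + 1" using assms by (intro connected_on_card_le) auto
  then show False using assms(5) card_Suc_Diff1[OF assms(2) eT] by simp
qed

text \<open>A walk that returns to a vertex of the path found so far is cut back to that vertex;
  otherwise the path is prolonged.\<close>

lemma reach_simple_path:
  assumes "reach F inc x y"
  shows "\<exists>vs es. length vs = length es + 1 \<and> distinct vs \<and> vs ! 0 = x \<and> vs ! length es = y \<and>
           set es \<subseteq> F \<and> (\<forall>i < length es. inc (es ! i) = {vs ! i, vs ! (i + 1)})"
  using assms
proof (induction rule: reach.induct)
  case (refl x)
  show ?case by (intro exI[of _ "[x]"] exI[of _ "[]"]) simp
next
  case (step x y e z)
  then obtain vs es where p: "length vs = length es + 1" "distinct vs" "vs ! 0 = x"
    "vs ! length es = y" "set es \<subseteq> F" "\<forall>i < length es. inc (es ! i) = {vs ! i, vs ! (i + 1)}"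
    by blast
  show ?case
  proof (cases "z \<in> set vs")
    case True
    then obtain k where k: "k < length vs" "vs ! k = z" by (auto simp: in_set_conv_nth)
    show ?thesis
      using p k by (intro exI[of _ "take (k + 1) vs"] exI[of _ "take k es"])
        (auto dest: in_set_takeD)
  next
    case False
    show ?thesis
      using p step(2,3) False by (intro exI[of _ "vs @ [z]"] exI[of _ "es @ [e]"])
        (auto simp: nth_append less_Suc_eq)
  qed
qed

text \<open>The edge \<open>e\<close> closes a simple path from \<open>a\<close> to
  \<open>b\<close>. For a loop this path is a single vertex.\<close>

lemma reach_imp_cycle:
  assumes "e \<in> F" "inc e = {a, b}" "reach (F - {e}) inc a b" "\<And>e. e \<in> F \<Longrightarrow> inc e \<subseteq> X"
  shows "has_cycle X F inc"
proof -
  from reach_simple_path[OF assms(3)] obtain vs es where p: "length vs = length es + 1"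
    "distinct vs" "vs ! 0 = a" "vs ! length es = b" "set es \<subseteq> F - {e}"
    "\<forall>i < length es. inc (es ! i) = {vs ! i, vs ! (i + 1)}"
    by blast
  have "es ! i \<noteq> es ! j" if "i < j" "j < length es" for i j
  proof
    assume "es ! i = es ! j"
    then have "{vs ! i, vs ! (i + 1)} = {vs ! j, vs ! (j + 1)}" using p(6) that by (metis order_less_trans)
    then have "vs ! i = vs ! j \<or> vs ! i = vs ! (j + 1)" by (metis doubleton_eq_iff)
    then show False using p(1,2) that by (auto simp: nth_eq_iff_index_eq)
  qed
  then have "distinct es" unfolding distinct_conv_nth by (metis linorder_neqE_nat)
  then have d: "distinct (es @ [e])" using p(5) by auto
  have "vs ! i \<in> X" if "i < length vs" for i
  proof (cases "i = length es")
    case True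
    then show ?thesis using p(4) assms(1,2,4) by blast
  next
    case False
    then have "i < length es" using that p(1) by simp
    then have "vs ! i \<in> inc (es ! i)" "es ! i \<in> F" using p(5,6) nth_mem by blast+
    then show ?thesis using assms(4) by blast
  qed
  then have "set vs \<subseteq> X" by (auto simp: in_set_conv_nth)
  moreover have "inc ((es @ [e]) ! i) = {vs ! i, vs ! ((i + 1) mod length (es @ [e]))}"
    if "i < length (es @ [e])" for i
    using that p assms(2) by (cases "i = length es") (auto simp: nth_append insert_commute)
  ultimately show ?thesis
    unfolding has_cycle_def using p d assms(1)
    by (intro exI[of _ vs] exI[of _ "es @ [e]"]) auto
qed

text \<open>A bridge \<open>e\<close> splits \<open>X\<close> into two sides, and the other edges
  stay bridges within their side. By induction the sides have at most \<open>card C - 1\<close> and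
  \<open>card (X - C) - 1\<close> edges, to which \<open>e\<close> adds one.\<close>

lemma bridges_card_less:
  assumes "finite X" "X \<noteq> {}" "finite F" "\<And>e. e \<in> F \<Longrightarrow> inc e \<subseteq> X"
    and "\<And>e. e \<in> F \<Longrightarrow> \<exists>a b. inc e = {a, b} \<and> \<not> reach (F - {e}) inc a b"
  shows "card F < card X"
  using assms
proof (induction "card F" arbitrary: F X rule: less_induct)
  case less
  show ?case
  proof (cases "F = {}")
    case True
    then show ?thesis using less.prems by (simp add: card_gt_0_iff)
  next
    case False
    then obtain e a b where e: "e \<in> F" "inc e = {a, b}" "\<not> reach (F - {e}) inc a b"
      using less.prems(5) by blast
    define C where "C = {x \<in> X. reach (F - {e}) inc a x}"
    have ab: "a \<in> C" "b \<in> X - C" using e less.prems(4)[of e] by (auto simp: C_def reach.refl)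
    have stay: "inc f \<subseteq> C \<or> inc f \<subseteq> X - C" if f: "f \<in> F - {e}" for f
    proof -
      obtain c d where cd: "inc f = {c, d}" using less.prems(5) f by blast
      have "reach (F - {e}) inc c d" "reach (F - {e}) inc d c"
        using f cd by (auto intro!: reach_edge[of f] simp: insert_commute)
      then show ?thesis using cd less.prems(4)[of f] f by (auto simp: C_def intro: reach_trans)
    qed
    let ?I = "\<lambda>Y. {f \<in> F - {e}. inc f \<subseteq> Y}"
    have "card (?I Y) < card Y" if "Y \<subseteq> X" "Y \<noteq> {}" for Y
    proof (rule less.hyps)
      show "card (?I Y) < card F"
        using e less.prems(3) by (intro psubset_card_mono) auto
      show "\<exists>a b. inc f = {a, b} \<and> \<not> reach (?I Y - {f}) inc a b" if "f \<in> ?I Y" for f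
        using less.prems(5)[of f] that reach_mono[of "?I Y - {f}" inc _ _ "F - {f}"] by blast
    qed (use that less.prems in \<open>auto intro: finite_subset\<close>)
    from this[of C] this[of "X - C"] ab
    have "card (?I C) < card C" "card (?I (X - C)) < card (X - C)" by (auto simp: C_def)
    moreover have "F = insert e (?I C \<union> ?I (X - C))" using stay e by auto
    then have "card F = card (insert e (?I C \<union> ?I (X - C)))" by (rule arg_cong)
    then have "card F = Suc (card (?I C \<union> ?I (X - C)))"
      using less.prems(3) by (subst (asm) card_insert_disjoint) auto
    moreover have "card (?I C \<union> ?I (X - C)) \<le> card (?I C) + card (?I (X - C))"
      by (rule card_Un_le)
    moreover have "card (X - C) = card X - card C" "card C \<le> card X"
      using less.prems(1) by (auto simp: C_def card_Diff_subset intro!: card_mono)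
    ultimately show ?thesis by linarith
  qed
qed

text \<open>In an acyclic graph no edge can be bypassed, so every edge is a bridge.\<close>

lemma card_ge_imp_cycle:
  assumes "finite X" "X \<noteq> {}" "finite F" "\<And>e. e \<in> F \<Longrightarrow> inc e \<subseteq> X"
    and "\<And>e. e \<in> F \<Longrightarrow> card (inc e) = 1 \<or> card (inc e) = 2" and "card X \<le> card F"
  shows "has_cycle X F inc"
proof (rule ccontr)
  assume "\<not> has_cycle X F inc"
  have "\<exists>a b. inc e = {a, b} \<and> \<not> reach (F - {e}) inc a b" if e: "e \<in> F" for e
  proof -
    obtain a b where "inc e = {a, b}" using assms(5)[OF e]
      by (metis card_1_singletonE card_2_iff insert_absorb2)
    then show ?thesis
      using reach_imp_cycle[OF e, of inc a b X] assms(4) \<open>\<not> has_cycle X F inc\<close> by blast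
  qed
  from bridges_card_less[OF assms(1-4) this] assms(6) show False by simp
qed

section \<open>Deleting leaves of a tree\<close>

lemma tree_remove_leaf:
  assumes "finite X" "finite T" "connected_on X T inc" "\<And>e. e \<in> T \<Longrightarrow> inc e \<subseteq> X"
    and "card T + 1 = card X" "v \<in> X" "X \<noteq> {v}" "card {e \<in> T. v \<in> inc e} \<le> 1"
  shows "connected_on (X - {v}) (induced_edges T inc (X - {v})) inc \<and>
         card (induced_edges T inc (X - {v})) + 1 = card (X - {v})"
proof -
  let ?T = "induced_edges T inc (X - {v})"
  have Teq: "?T = T - {e \<in> T. v \<in> inc e}" using assms(4) by (auto simp: induced_edges_def)
  obtain x0 where x0: "x0 \<in> X" "x0 \<noteq> v" using assms(6,7) by blast
  have "reach T inc v x0" using assms(3,6) x0 by (auto simp: connected_on_def)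
  from reach_leaves_set[OF this, of "{v}"] x0 obtain g b
    where g: "g \<in> T" "inc g = {v, b}" "b \<noteq> v" by auto
  have uniq: "e = g" if "e \<in> T" "v \<in> inc e" for e
    using assms(8) g that assms(2) by (auto simp: card_le_Suc0_iff_eq)
  then have "{e \<in> T. v \<in> inc e} = {g}" using g(1,2) by blast
  then have "?T = T - {g}" using Teq by simp
  then have "card ?T + 1 = card T" using g(1) assms(2) card_Suc_Diff1 by fastforce
  then have cardT: "card ?T + 1 = card (X - {v})" using assms(1,5,6) by simp
  \<comment> \<open>A walk visits the leaf \<open>v\<close> only along its single edge
    \<open>g\<close>; while it stands at \<open>v\<close>, the invariant tracks the neighbour
    \<open>b\<close> instead.\<close>
  have "(y \<noteq> v \<longrightarrow> reach ?T inc x y) \<and> (y = v \<longrightarrow> reach ?T inc x b)"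
    if "reach T inc x y" "x \<noteq> v" for x y
    using that
  proof (induction rule: reach.induct)
    case (step x y e z)
    show ?case
    proof (cases "e = g")
      case True
      with step g have "y = v \<and> z = b \<or> y = b \<and> z = v" by (auto simp: doubleton_eq_iff)
      then show ?thesis using step g by auto
    next
      case False
      then have "v \<notin> inc e" using uniq step by blast
      then have "e \<in> ?T" "y \<noteq> v" "z \<noteq> v" using Teq step by auto
      then show ?thesis using step by (auto intro: reach.step)
    qed
  qed (auto intro: reach.refl)
  then have "connected_on (X - {v}) ?T inc"
    using assms(3) x0 by (auto simp: connected_on_def)
  with cardT show ?thesis by simp
qed

text \<open>Leaves can be deleted one at a time: degrees in the tree only drop, and since
  \<open>J\<close> is a proper subset of \<open>X\<close> the last vertex is never deleted.\<close>

lemma tree_remove_leaves: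
  assumes "finite J" "J \<subset> X" "finite X" "finite T" "connected_on X T inc"
    and "\<And>e. e \<in> T \<Longrightarrow> inc e \<subseteq> X" "card T + 1 = card X"
    and "\<And>v. v \<in> J \<Longrightarrow> card {e \<in> T. v \<in> inc e} \<le> 1"
  shows "connected_on (X - J) (induced_edges T inc (X - J)) inc \<and>
         card (induced_edges T inc (X - J)) + 1 = card (X - J)"
  using assms(1,2,8)
proof (induction J rule: finite_induct)
  case empty
  have "induced_edges T inc X = T" using assms(6) by (auto simp: induced_edges_def)
  then show ?case using assms by simp
next
  case (insert v J)
  let ?X = "X - J" and ?T = "induced_edges T inc (X - J)"
  have IH: "connected_on ?X ?T inc" "card ?T + 1 = card ?X" using insert by auto
  have "card {e \<in> ?T. v \<in> inc e} \<le> card {e \<in> T. v \<in> inc e}"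
    using assms(4) by (intro card_mono) (auto simp: induced_edges_def)
  then have deg: "card {e \<in> ?T. v \<in> inc e} \<le> 1" using insert.prems(2)[of v] by simp
  have "?X \<noteq> {v}" "v \<in> ?X" using insert by auto
  have "X - J - {v} = X - insert v J" by auto
  moreover have "induced_edges ?T inc (X - insert v J) = induced_edges T inc (X - insert v J)"
    by (auto simp: induced_edges_def)
  moreover have "connected_on (?X - {v}) (induced_edges ?T inc (?X - {v})) inc \<and>
         card (induced_edges ?T inc (?X - {v})) + 1 = card (?X - {v})"
    by (rule tree_remove_leaf)
      (use assms IH deg \<open>?X \<noteq> {v}\<close> \<open>v \<in> ?X\<close> in \<open>auto simp: induced_edges_def\<close>)
  ultimately show ?case by simp
qed

section \<open>Orientations with prescribed in-degrees\<close>

lemma sum_card_fibres: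
  assumes "finite A" "finite F"
  shows "(\<Sum>x\<in>A. card {f \<in> F. \<psi> f = x}) = card {f \<in> F. \<psi> f \<in> A}"
proof -
  have "card (\<Union>x\<in>A. {f \<in> F. \<psi> f = x}) = (\<Sum>x\<in>A. card {f \<in> F. \<psi> f = x})"
    using assms by (intro card_UN_disjoint) auto
  moreover have "(\<Union>x\<in>A. {f \<in> F. \<psi> f = x}) = {f \<in> F. \<psi> f \<in> A}" by auto
  ultimately show ?thesis by simp
qed

text \<open>If no end of \<open>f\<close> can be chosen, every end lies in a tight set; the union of these tight sets
  is again tight and spans \<open>f\<close>, which breaks the counting condition.\<close>

lemma bounded_choice:
  fixes d :: "'p \<Rightarrow> nat"
  assumes "finite P" "finite F" "\<And>f. f \<in> F \<Longrightarrow> N f \<subseteq> P"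
    and "\<And>Y. Y \<subseteq> P \<Longrightarrow> card {f \<in> F. N f \<subseteq> Y} \<le> sum d Y"
  shows "\<exists>\<psi>. (\<forall>f\<in>F. \<psi> f \<in> N f) \<and> (\<forall>C\<in>P. card {f \<in> F. \<psi> f = C} \<le> d C)"
  using assms(2-4)
proof (induction F arbitrary: d rule: finite_induct)
  case empty
  then show ?case by simp
next
  case (insert f F)
  let ?cnt = "\<lambda>Y. card {g \<in> F. N g \<subseteq> Y}"
  have cnt_le: "?cnt Y \<le> sum d Y" if "Y \<subseteq> P" for Y
  proof -
    have "?cnt Y \<le> card {g \<in> insert f F. N g \<subseteq> Y}"
      using insert.hyps(1) by (intro card_mono) auto
    with insert.prems(2)[OF that] show ?thesis by simp
  qed
  define tight where "tight Y \<longleftrightarrow> Y \<subseteq> P \<and> ?cnt Y = sum d Y" for Y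
  \<comment> \<open>Counting edges inside a set is supermodular and \<open>sum d\<close> is modular,
    so equality for two sets forces equality for their union.\<close>
  have tight_Un: "tight (Y \<union> Z)" if "tight Y" "tight Z" for Y Z
  proof -
    have fin: "finite Y" "finite Z" using that assms(1) by (auto simp: tight_def intro: finite_subset)
    have "{g \<in> F. N g \<subseteq> Y \<inter> Z} = {g \<in> F. N g \<subseteq> Y} \<inter> {g \<in> F. N g \<subseteq> Z}" by auto
    moreover have "card ({g \<in> F. N g \<subseteq> Y} \<union> {g \<in> F. N g \<subseteq> Z}) \<le> ?cnt (Y \<union> Z)"
      using insert.hyps(1) by (intro card_mono) auto
    ultimately have "?cnt Y + ?cnt Z \<le> ?cnt (Y \<union> Z) + ?cnt (Y \<inter> Z)"
      using card_Un_Int[of "{g \<in> F. N g \<subseteq> Y}" "{g \<in> F. N g \<subseteq> Z}"] insert.hyps(1) by simp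
    moreover have "sum d Y + sum d Z = sum d (Y \<union> Z) + sum d (Y \<inter> Z)"
      using sum.union_inter[OF fin, of d] by simp
    moreover have "?cnt (Y \<inter> Z) \<le> sum d (Y \<inter> Z)" "?cnt (Y \<union> Z) \<le> sum d (Y \<union> Z)"
      using that by (intro cnt_le; auto simp: tight_def)+
    ultimately show ?thesis using that by (simp add: tight_def)
  qed
  have "\<exists>C\<in>N f. \<forall>Y. C \<in> Y \<longrightarrow> \<not> tight Y"
  proof (rule ccontr)
    assume "\<not> ?thesis"
    then have ex: "\<exists>Y. C \<in> Y \<and> tight Y" if "C \<in> N f" for C using that by blast
    have fin: "finite (N f)" using insert.prems(1)[of f] assms(1) by (auto intro: finite_subset)
    have "\<exists>Y. A \<subseteq> Y \<and> tight Y" if "finite A" "A \<subseteq> N f" for A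
      using that
    proof (induction A rule: finite_induct)
      case empty
      have "tight {}" using cnt_le[of "{}"] by (simp add: tight_def)
      then show ?case by blast
    next
      case (insert C A)
      then show ?case using ex[of C] tight_Un by (metis Un_iff insert_subset subsetI subsetD)
    qed
    with fin obtain Y where Y: "N f \<subseteq> Y" "tight Y" by blast
    then have "{g \<in> insert f F. N g \<subseteq> Y} = insert f {g \<in> F. N g \<subseteq> Y}" by auto
    then have "card {g \<in> insert f F. N g \<subseteq> Y} = Suc (?cnt Y)" using insert.hyps by simp
    then show False using insert.prems(2)[of Y] Y by (simp add: tight_def)
  qed
  then obtain C where C: "C \<in> N f" "\<And>Y. C \<in> Y \<Longrightarrow> \<not> tight Y" by blast
  have CP: "C \<in> P" using C insert.prems(1) by blast
  have "d C \<noteq> 0" using C(2)[of "{C}"] CP cnt_le[of "{C}"] by (auto simp: tight_def)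
  \<comment> \<open>Assigning \<open>f\<close> to \<open>C\<close> uses up one unit of
    \<open>d C\<close>. Only sets containing \<open>C\<close> lose capacity, and they have room
    because none of them is tight.\<close>
  define d' where "d' = d(C := d C - 1)"
  have "?cnt Y \<le> sum d' Y" if "Y \<subseteq> P" for Y
  proof (cases "C \<in> Y")
    case True
    have fin: "finite Y" using that assms(1) by (rule finite_subset)
    have "sum d Y = d C + sum d (Y - {C})" using sum.remove[OF fin True] .
    moreover have "sum d' Y = d C - 1 + sum d (Y - {C})"
      using sum.remove[OF fin True, of d'] by (simp add: d'_def)
    moreover have "?cnt Y < sum d Y"
      using cnt_le[OF that] C(2)[OF True] that by (auto simp: tight_def)
    ultimately show ?thesis by linarith
  next
    case False
    then have "sum d' Y = sum d Y" unfolding d'_def by (intro sum.cong) auto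
    then show ?thesis using cnt_le[OF that] by simp
  qed
  then obtain \<psi> where \<psi>: "\<forall>f\<in>F. \<psi> f \<in> N f" "\<forall>C\<in>P. card {f \<in> F. \<psi> f = C} \<le> d' C"
    using insert.IH[of d'] insert.prems(1) by blast
  define \<psi>' where "\<psi>' = \<psi>(f := C)"
  have "card {g \<in> insert f F. \<psi>' g = D} \<le> d D" if "D \<in> P" for D
  proof (cases "D = C")
    case True
    have "{g \<in> insert f F. \<psi>' g = D} = insert f {g \<in> F. \<psi> g = C}"
      using True insert.hyps by (auto simp: \<psi>'_def)
    then have "card {g \<in> insert f F. \<psi>' g = D} = Suc (card {g \<in> F. \<psi> g = C})"
      using insert.hyps by simp
    moreover have "card {g \<in> F. \<psi> g = C} \<le> d C - 1"
      using bspec[OF \<psi>(2) CP] by (simp add: d'_def)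
    ultimately show ?thesis using \<open>d C \<noteq> 0\<close> True by simp
  next
    case False
    have "{g \<in> insert f F. \<psi>' g = D} = {g \<in> F. \<psi> g = D}"
      using False insert.hyps by (auto simp: \<psi>'_def)
    then show ?thesis using bspec[OF \<psi>(2) that] False by (simp add: d'_def)
  qed
  moreover have "\<psi>' g \<in> N g" if "g \<in> insert f F" for g
    using \<psi>(1) C(1) that by (auto simp: \<psi>'_def)
  ultimately show ?case by blast
qed

text \<open>The bounds add up to \<open>card F\<close>, so each of them is attained.\<close>

lemma exact_choice:
  fixes d :: "'p \<Rightarrow> nat"
  assumes "finite P" "finite F" "\<And>f. f \<in> F \<Longrightarrow> N f \<subseteq> P"
    and "\<And>Y. Y \<subseteq> P \<Longrightarrow> card {f \<in> F. N f \<subseteq> Y} \<le> sum d Y"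
    and "card F = sum d P"
  shows "\<exists>\<psi>. (\<forall>f\<in>F. \<psi> f \<in> N f) \<and> (\<forall>C\<in>P. card {f \<in> F. \<psi> f = C} = d C)"
proof -
  obtain \<psi> where \<psi>: "\<forall>f\<in>F. \<psi> f \<in> N f" "\<forall>C\<in>P. card {f \<in> F. \<psi> f = C} \<le> d C"
    using bounded_choice[OF assms(1-4)] by blast
  have "{f \<in> F. \<psi> f \<in> P} = F" using \<psi>(1) assms(3) by blast
  then have "(\<Sum>C\<in>P. card {f \<in> F. \<psi> f = C}) = sum d P"
    using sum_card_fibres[OF assms(1,2), of \<psi>] assms(5) by simp
  then have "\<forall>C\<in>P. card {f \<in> F. \<psi> f = C} = d C"
    using sum_mono_inv[of "\<lambda>C. card {f \<in> F. \<psi> f = C}" P d] \<psi>(2) assms(1) by blast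
  with \<psi>(1) show ?thesis by blast
qed

text \<open>Here \<open>\<psi> f\<close> is the part that the edge \<open>f\<close> is oriented towards.\<close>

lemma connected_parts_tree:
  assumes P: "partition_on X P" "finite P" "R \<in> P"
    and enter: "\<And>Y. Y \<subseteq> P \<Longrightarrow> Y \<noteq> {} \<Longrightarrow> R \<notin> Y \<Longrightarrow>
      \<exists>f\<in>F. \<exists>a b. inc f = {a, b} \<and> \<psi> f \<in> Y \<and> a \<in> \<psi> f \<and> b \<in> X \<and> b \<notin> \<Union>Y"
  shows "\<exists>T\<subseteq>F. (\<forall>S. (\<forall>C\<in>P. connected_on C S inc) \<longrightarrow> connected_on X (S \<union> T) inc) \<and>
           (\<forall>C\<in>P. card {f \<in> T. \<psi> f = C} = (if C = R then 0 else 1))"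
proof -
  have UP: "\<Union>P = X" using P(1) by (simp add: partition_on_def)
  \<comment> \<open>A maximal set \<open>Z\<close> of parts joined to the root is sought.
    Connectivity is stated for every \<open>S\<close> because the trees inside the parts are chosen
    only later.\<close>
  define good where "good Z \<longleftrightarrow> Z \<subseteq> P \<and> R \<in> Z \<and> (\<exists>T\<subseteq>F.
     (\<forall>S. (\<forall>C\<in>P. connected_on C S inc) \<longrightarrow> connected_on (\<Union>Z) (S \<union> T) inc) \<and>
     \<psi> ` T \<subseteq> Z \<and> (\<forall>C\<in>Z. card {f \<in> T. \<psi> f = C} = (if C = R then 0 else 1)))" for Z
  have "good {R}" using P(3) unfolding good_def by (auto intro!: exI[of _ "{}"])
  moreover have "finite {Z. good Z}"
    by (rule finite_subset[of _ "Pow P"]) (use P(2) in \<open>auto simp: good_def\<close>)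
  ultimately obtain Z where Z: "good Z" and max: "\<And>Z'. good Z' \<Longrightarrow> Z \<subseteq> Z' \<Longrightarrow> Z' = Z"
    using finite_has_maximal[of "{Z. good Z}"] by (metis empty_iff mem_Collect_eq)
  from Z have ZP: "Z \<subseteq> P" "R \<in> Z" by (simp_all add: good_def)
  from Z[unfolded good_def] obtain T where T: "T \<subseteq> F"
    "\<forall>S. (\<forall>C\<in>P. connected_on C S inc) \<longrightarrow> connected_on (\<Union>Z) (S \<union> T) inc" "\<psi> ` T \<subseteq> Z"
    "\<forall>C\<in>Z. card {f \<in> T. \<psi> f = C} = (if C = R then 0 else 1)"
    by (elim conjE exE)
  have "Z = P"
  proof (rule ccontr)
    assume "Z \<noteq> P"
    \<comment> \<open>The hypothesis \<open>enter\<close> is applied to the parts not yet joined, so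
      the end \<open>b\<close> lies in a joined part.\<close>
    then obtain f a b where f: "f \<in> F" "inc f = {a, b}" "\<psi> f \<in> P - Z" "a \<in> \<psi> f" "b \<in> X"
      "b \<notin> \<Union>(P - Z)"
      using enter[of "P - Z"] ZP by blast
    let ?Z = "insert (\<psi> f) Z" and ?T = "insert f T"
    have bZ: "b \<in> \<Union>Z" using f(5,6) UP by blast
    have "connected_on (\<Union>?Z) (S \<union> ?T) inc" if S: "\<forall>C\<in>P. connected_on C S inc" for S
    proof (rule connected_onI_root[of b])
      show "b \<in> \<Union>?Z" using bZ by auto
      fix x assume "x \<in> \<Union>?Z"
      then consider "x \<in> \<Union>Z" | "x \<in> \<psi> f" by auto
      then show "reach (S \<union> ?T) inc b x"
      proof cases
        case 1
        then have "reach (S \<union> T) inc b x" using mp[OF spec[OF T(2)] S] bZ unfolding connected_on_def by blast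
        then show ?thesis by (rule reach_mono) auto
      next
        case 2
        then have "reach S inc a x" using bspec[OF S, of "\<psi> f"] f(3,4) by (simp add: connected_on_def)
        then have "reach (S \<union> ?T) inc a x" by (rule reach_mono) auto
        moreover have "reach (S \<union> ?T) inc b a"
          using f(2) by (intro reach_edge[of f]) (auto simp: insert_commute)
        ultimately show ?thesis by (blast intro: reach_trans)
      qed
    qed
    moreover have "card {g \<in> ?T. \<psi> g = C} = (if C = R then 0 else 1)" if "C \<in> ?Z" for C
    proof (cases "C = \<psi> f")
      case True
      then have "{g \<in> ?T. \<psi> g = C} = {f}" using T(3) f(3) by auto
      then show ?thesis using True f(3) ZP(2) by auto
    next
      case False
      then have "{g \<in> ?T. \<psi> g = C} = {g \<in> T. \<psi> g = C}" by auto
      then show ?thesis using T(4) that False by auto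
    qed
    ultimately have "good ?Z"
      unfolding good_def using T(1,3) f(1,3) ZP by (intro conjI exI[of _ ?T]) auto
    with max[of ?Z] f(3) show False by blast
  qed
  with T UP show ?thesis by blast
qed

section \<open>Spanning trees with a paired complement\<close>

text \<open>A connected part has cycle rank
  \<open>card (induced_edges D inc C) + 1 - card C\<close>. For connected parts, a sum of weights
  thus counts every part once and those of odd rank once more.\<close>

definition weight :: "('e \<Rightarrow> 'a set) \<Rightarrow> 'e set \<Rightarrow> 'a set \<Rightarrow> nat" where
  "weight inc D C = (if even (card (induced_edges D inc C) + card C) then 2 else 1)"

text \<open>An edge of \<open>E - D\<close> may still have both ends in the same part.\<close>

definition edge_partition ::
    "('e \<Rightarrow> 'a set) \<Rightarrow> 'a set \<Rightarrow> 'e set \<Rightarrow> 'a set set \<Rightarrow> 'e set \<Rightarrow> bool" where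
  "edge_partition inc X E P D \<longleftrightarrow>
     partition_on X P \<and> D \<subseteq> E \<and> (\<forall>e\<in>D. \<exists>C\<in>P. inc e \<subseteq> C)"

text \<open>When the parts are the components of \<open>(X, D)\<close>, weight 2 means odd cycle rank, and this is
  Nebesky's condition for \<open>F = E - D\<close>. Allowing parts that are not connected does not strengthen the
  condition and makes it closed under merging parts.\<close>

definition nebesky :: "('e \<Rightarrow> 'a set) \<Rightarrow> 'a set \<Rightarrow> 'e set \<Rightarrow> bool" where
  "nebesky inc X E \<longleftrightarrow> (\<forall>P D. edge_partition inc X E P D \<longrightarrow>
     (\<Sum>C\<in>P. weight inc D C) \<le> card (E - D) + 1)"

text \<open>\<open>L\<close> collects further edges, not available to the tree, that have to be paired as well.\<close>

definition paired_cotree ::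
    "('e \<Rightarrow> 'a set) \<Rightarrow> 'a set \<Rightarrow> 'e set \<Rightarrow> 'e set \<Rightarrow> bool" where
  "paired_cotree inc X E L \<longleftrightarrow>
     (\<exists>T \<phi>. T \<subseteq> E \<and> connected_on X T inc \<and> card T + 1 = card X \<and>
       (\<forall>e\<in>(E - T) \<union> L. \<phi> e \<in> inc e \<inter> X) \<and>
       (\<forall>v. even (card {e \<in> (E - T) \<union> L. \<phi> e = v})))"

section \<open>Counting and parity for weights of partitions\<close>

lemma weight_pos: "weight inc D C \<ge> 1"
  by (simp add: weight_def)

lemma even_weight_iff: "even (weight inc D C) \<longleftrightarrow> even (card (induced_edges D inc C) + card C)"
  by (simp add: weight_def)

lemma multigraph_inc_ne: "multigraph X E inc \<Longrightarrow> e \<in> E \<Longrightarrow> inc e \<noteq> {}"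
  unfolding multigraph_def by (metis card.empty zero_neq_numeral zero_neq_one)

lemma multigraph_mono: "multigraph X E inc \<Longrightarrow> D \<subseteq> E \<Longrightarrow> multigraph X D inc"
  unfolding multigraph_def by (auto intro: finite_subset)

lemma multigraph_induced:
  "multigraph X E inc \<Longrightarrow> C \<subseteq> X \<Longrightarrow> multigraph C (induced_edges E inc C) inc"
  unfolding multigraph_def induced_edges_def by (auto intro: finite_subset)

lemma partition_on_finite: "finite X \<Longrightarrow> partition_on X P \<Longrightarrow> finite P"
  by (rule finite_elements)

lemma partition_part:
  assumes "partition_on X P" "C \<in> P" "C' \<in> P" "x \<in> C" "x \<in> C'"
  shows "C = C'"
  using assms by (auto simp: partition_on_def disjoint_def)

lemma sum_card_induced:
  assumes "multigraph X E inc" "edge_partition inc X E P D"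
  shows "(\<Sum>C\<in>P. card (induced_edges D inc C)) = card D"
proof -
  have fin: "finite P" "finite D"
    using assms partition_on_finite
    by (auto simp: multigraph_def edge_partition_def intro: finite_subset)
  have "card (\<Union>C\<in>P. induced_edges D inc C) = (\<Sum>C\<in>P. card (induced_edges D inc C))"
  proof (rule card_UN_disjoint)
    show "\<forall>A\<in>P. \<forall>B\<in>P. A \<noteq> B \<longrightarrow> induced_edges D inc A \<inter> induced_edges D inc B = {}"
    proof (intro ballI impI)
      fix A B assume AB: "A \<in> P" "B \<in> P" "A \<noteq> B"
      then have "A \<inter> B = {}"
        using assms(2) by (auto simp: edge_partition_def partition_on_def disjoint_def)
      then show "induced_edges D inc A \<inter> induced_edges D inc B = {}"
        using multigraph_inc_ne[OF assms(1)] assms(2)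
        by (fastforce simp: induced_edges_def edge_partition_def)
    qed
  qed (use fin in \<open>auto simp: induced_edges_def\<close>)
  moreover have "(\<Union>C\<in>P. induced_edges D inc C) = D"
    using assms(2) by (fastforce simp: induced_edges_def edge_partition_def)
  ultimately show ?thesis by simp
qed

lemma sum_card_parts:
  assumes "finite X" "partition_on X P"
  shows "(\<Sum>C\<in>P. card C) = card X"
proof -
  have "finite C" if "C \<in> P" for C
    using assms(1) partition_onD1[OF assms(2)] that by (auto intro: finite_subset)
  then have "card (\<Union>P) = (\<Sum>C\<in>P. card C)"
    using partition_onD2[OF assms(2)] by (intro card_Union_disjoint)
  then show ?thesis using partition_onD1[OF assms(2)] by simp
qed

text \<open>The parity of the total weight depends only on \<open>card D\<close>, so the difference
  between the two sides of Nebesky's inequality has the same parity for all pairs.\<close>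

lemma even_sum_weight_iff:
  assumes "multigraph X E inc" "edge_partition inc X E P D"
  shows "even (\<Sum>C\<in>P. weight inc D C) \<longleftrightarrow> even (card D + card X)"
proof -
  have fin: "finite P" "finite X" and part: "partition_on X P"
    using assms partition_on_finite by (auto simp: multigraph_def edge_partition_def)
  have "even (\<Sum>C\<in>P. weight inc D C) \<longleftrightarrow>
      even (\<Sum>C\<in>P. card (induced_edges D inc C) + card C)"
    using fin(1) by (induction P rule: finite_induct) (auto simp: even_weight_iff)
  then show ?thesis
    using sum_card_induced[OF assms] sum_card_parts[OF fin(2) part]
    by (simp add: sum.distrib)
qed

lemma card_parts_le_sum_weight: "card P \<le> (\<Sum>C\<in>P. weight inc D C)"
proof -
  have "(\<Sum>C\<in>P. 1) \<le> (\<Sum>C\<in>P. weight inc D C)" by (intro sum_mono weight_pos)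
  then show ?thesis by simp
qed

section \<open>Refining and merging partitions\<close>

text \<open>Splitting one part changes weights, outside edges and the number of parts only by the
  terms of that part. The identities carry Nebesky's inequality from \<open>X\<close> over to a
  single part.\<close>

lemma refine_part:
  assumes mg: "multigraph X E inc" and ep: "edge_partition inc X E P D" and C: "C \<in> P"
    and eq: "edge_partition inc C (induced_edges D inc C) Q D1"
  defines "P' \<equiv> (P - {C}) \<union> Q" and "D' \<equiv> (D - induced_edges D inc C) \<union> D1"
  shows "edge_partition inc X E P' D'"
    and "(\<Sum>B\<in>P'. weight inc D' B) + weight inc D C =
         (\<Sum>B\<in>P. weight inc D B) + (\<Sum>B\<in>Q. weight inc D1 B)"
    and "card (E - D') = card (E - D) + card (induced_edges D inc C - D1)"
    and "card P' + 1 = card P + card Q"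
proof -
  have part: "partition_on X P" "partition_on C Q" and sub: "D \<subseteq> E" "D1 \<subseteq> induced_edges D inc C"
    using ep eq by (auto simp: edge_partition_def)
  have CX: "C \<subseteq> X" using part C by (auto simp: partition_on_def)
  have fin: "finite P" "finite Q" "finite E" "finite D"
    using mg part CX sub partition_on_finite[of X P] partition_on_finite[of C Q]
      finite_subset[of D E] finite_subset[of C X]
    by (simp_all add: multigraph_def)
  have ne: "inc e \<noteq> {}" if "e \<in> D" for e using multigraph_inc_ne[OF mg] sub that by blast
  have disj: "B \<inter> C = {}" if "B \<in> P - {C}" for B
    using that C part(1) by (auto simp: partition_on_def disjoint_def)
  have QC: "B \<subseteq> C" "B \<noteq> {}" if "B \<in> Q" for B using that part(2) by (auto simp: partition_on_def)
  have "B \<notin> Q" if "B \<in> P - {C}" for B using disj[OF that] QC[of B] by auto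
  then have PQ: "(P - {C}) \<inter> Q = {}" by auto
  have UX: "\<Union>P = X" using part(1) by (simp add: partition_on_def)
  have UP: "\<Union>(P - {C}) = X - C"
  proof
    show "\<Union>(P - {C}) \<subseteq> X - C" using disj UX by auto
    show "X - C \<subseteq> \<Union>(P - {C})" using UX by auto
  qed
  have "\<Union>P' = X"
    using UP CX partition_onD1[OF part(2)] by (auto simp: P'_def)
  moreover have "disjoint P'"
    unfolding P'_def
  proof (rule disjoint_union)
    show "disjoint (P - {C})" using partition_onD2[OF part(1)] by (rule pairwise_subset) auto
    show "disjoint Q" using partition_onD2[OF part(2)] .
    show "\<Union>(P - {C}) \<inter> \<Union>Q = {}" using UP partition_onD1[OF part(2)] by auto
  qed
  moreover have "{} \<notin> P'"
    using partition_onD3[OF part(1)] partition_onD3[OF part(2)] by (simp add: P'_def)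
  ultimately have p': "partition_on X P'" by (simp add: partition_on_def)
  show "edge_partition inc X E P' D'"
    unfolding edge_partition_def
  proof (intro conjI ballI p')
    show "D' \<subseteq> E" using sub by (auto simp: D'_def induced_edges_def)
    fix e assume "e \<in> D'"
    then consider "e \<in> D" "\<not> inc e \<subseteq> C" | "e \<in> D1" by (auto simp: D'_def induced_edges_def)
    then show "\<exists>B\<in>P'. inc e \<subseteq> B"
    proof cases
      case 1
      then obtain B where "B \<in> P" "inc e \<subseteq> B" using ep unfolding edge_partition_def by blast
      with 1 show ?thesis by (auto simp: P'_def)
    next
      case 2
      then obtain B where "B \<in> Q" "inc e \<subseteq> B" using eq unfolding edge_partition_def by blast
      then show ?thesis by (auto simp: P'_def)
    qed
  qed
  have "weight inc D' B = weight inc D B" if B: "B \<in> P - {C}" for B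
  proof -
    have "e \<notin> induced_edges D inc C" if "e \<in> D" "inc e \<subseteq> B" for e
      using that ne[of e] disj[OF B] by (auto simp: induced_edges_def)
    then have "induced_edges D' inc B = induced_edges D inc B"
      using sub(2) by (auto simp: D'_def induced_edges_def)
    then show ?thesis by (simp add: weight_def)
  qed
  moreover have "weight inc D' B = weight inc D1 B" if B: "B \<in> Q" for B
  proof -
    have "induced_edges D' inc B = induced_edges D1 inc B"
      using QC(1)[OF B] by (auto simp: D'_def induced_edges_def)
    then show ?thesis by (simp add: weight_def)
  qed
  ultimately have "(\<Sum>B\<in>P'. weight inc D' B) =
      (\<Sum>B\<in>P - {C}. weight inc D B) + (\<Sum>B\<in>Q. weight inc D1 B)"
    unfolding P'_def using PQ fin by (simp add: sum.union_disjoint)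
  moreover have "(\<Sum>B\<in>P. weight inc D B) = weight inc D C + (\<Sum>B\<in>P - {C}. weight inc D B)"
    using fin(1) C by (rule sum.remove)
  ultimately show "(\<Sum>B\<in>P'. weight inc D' B) + weight inc D C =
         (\<Sum>B\<in>P. weight inc D B) + (\<Sum>B\<in>Q. weight inc D1 B)"
    by simp
  have "E - D' = (E - D) \<union> (induced_edges D inc C - D1)"
    using sub by (auto simp: D'_def induced_edges_def)
  moreover have "(E - D) \<inter> (induced_edges D inc C - D1) = {}" by (auto simp: induced_edges_def)
  ultimately show "card (E - D') = card (E - D) + card (induced_edges D inc C - D1)"
    using fin by (simp add: card_Un_disjoint induced_edges_def)
  show "card P' + 1 = card P + card Q"
    unfolding P'_def using PQ fin C card_Suc_Diff1[OF fin(1) C] by (simp add: card_Un_disjoint)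
qed

text \<open>The parts in \<open>Y\<close> are merged into one, which keeps all edges
  \<open>G\<close> inside their union. The merged part weighs at least 1, and Nebesky's inequality
  for the merged pair is compared with tightness of the old one.\<close>

lemma merge_parts:
  assumes mg: "multigraph X E inc" and neb: "nebesky inc X E"
    and ep: "edge_partition inc X E P D"
    and tight: "(\<Sum>C\<in>P. weight inc D C) = card (E - D) + 1"
    and Y: "Y \<subseteq> P" "Y \<noteq> {}"
  shows "card {f \<in> E - D. inc f \<subseteq> \<Union>Y} + 1 \<le> (\<Sum>C\<in>Y. weight inc D C)"
proof -
  define G where "G = {f \<in> E - D. inc f \<subseteq> \<Union>Y}"
  define P' where "P' = insert (\<Union>Y) (P - Y)"
  have part: "partition_on X P" and sub: "D \<subseteq> E" using ep by (auto simp: edge_partition_def)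
  have fin: "finite P" "finite E"
    using mg part partition_on_finite by (auto simp: multigraph_def)
  have disj: "B \<inter> \<Union>Y = {}" if "B \<in> P - Y" for B
  proof -
    have "B \<inter> C = {}" if "C \<in> Y" for C
      using partition_onD2[OF part] \<open>B \<in> P - Y\<close> that Y(1) by (metis DiffE disjointD subsetD)
    then show ?thesis by auto
  qed
  have ne: "B \<noteq> {}" if "B \<in> P" for B using part that by (auto simp: partition_on_def)
  have UY: "\<Union>Y \<noteq> {}" using Y ne by blast
  have notin: "\<Union>Y \<notin> P - Y" using disj[of "\<Union>Y"] UY by auto
  have "\<Union>P' = X"
    using partition_onD1[OF part] Y(1) by (auto simp: P'_def)
  moreover have "disjoint P'"
  proof -
    have "disjoint (P - Y)" using partition_onD2[OF part] by (rule pairwise_subset) auto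
    moreover have "\<Union>(P - Y) \<inter> \<Union>{\<Union>Y} = {}" using disj by auto
    ultimately have "disjoint ((P - Y) \<union> {\<Union>Y})" by (intro disjoint_union) auto
    then show ?thesis by (simp add: P'_def)
  qed
  moreover have "{} \<notin> P'" using UY ne by (auto simp: P'_def)
  ultimately have "partition_on X P'" by (simp add: partition_on_def)
  moreover have "\<exists>C\<in>P'. inc e \<subseteq> C" if "e \<in> D \<union> G" for e
  proof (cases "inc e \<subseteq> \<Union>Y")
    case False
    then have "e \<in> D" using that by (simp add: G_def)
    then obtain C where C: "C \<in> P" "inc e \<subseteq> C"
      using ep unfolding edge_partition_def by blast
    with False have "C \<notin> Y" by auto
    with C show ?thesis by (auto simp: P'_def)
  qed (simp add: P'_def)
  ultimately have ep': "edge_partition inc X E P' (D \<union> G)"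
    using sub by (auto simp: edge_partition_def G_def)
  have "weight inc (D \<union> G) B = weight inc D B" if B: "B \<in> P - Y" for B
  proof -
    have "\<not> inc e \<subseteq> B" if "e \<in> G" for e
      using that disj[OF B] multigraph_inc_ne[OF mg, of e] by (auto simp: G_def)
    then have "induced_edges (D \<union> G) inc B = induced_edges D inc B"
      by (auto simp: induced_edges_def)
    then show ?thesis by (simp add: weight_def)
  qed
  then have "(\<Sum>B\<in>P'. weight inc (D \<union> G) B) =
      weight inc (D \<union> G) (\<Union>Y) + (\<Sum>B\<in>P - Y. weight inc D B)"
    unfolding P'_def using notin fin by simp
  moreover have "(\<Sum>B\<in>P'. weight inc (D \<union> G) B) \<le> card (E - (D \<union> G)) + 1"
    using neb ep' by (auto simp: nebesky_def)
  moreover have "(\<Sum>B\<in>P. weight inc D B) = (\<Sum>B\<in>P - Y. weight inc D B) + (\<Sum>B\<in>Y. weight inc D B)"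
    using sum.subset_diff[OF Y(1) fin(1)] .
  moreover have "card (E - D) = card (E - (D \<union> G)) + card G"
  proof -
    have "E - D = (E - (D \<union> G)) \<union> G" by (auto simp: G_def)
    then have "card (E - D) = card ((E - (D \<union> G)) \<union> G)" by simp
    also have "\<dots> = card (E - (D \<union> G)) + card G"
      using fin by (intro card_Un_disjoint) (auto simp: G_def)
    finally show ?thesis .
  qed
  ultimately show ?thesis
    using tight weight_pos[of inc "D \<union> G" "\<Union>Y"] unfolding G_def by linarith
qed

section \<open>Extending and gluing paired cotrees\<close>

text \<open>The tree is kept and both new edges are assigned to \<open>v\<close>, which raises the
  count there by 2. A new edge may go to \<open>E'\<close> or to \<open>L'\<close>, so an edge
  inside a part can be paired with one entering it.\<close>

lemma paired_cotree_add_pair: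
  assumes "paired_cotree inc X E L" and "finite E'" "finite L'"
    and "E \<subseteq> E'" "L \<subseteq> L'" "E' \<union> L' = E \<union> L \<union> {e1, e2}" "E' \<inter> L' = {}"
    and "e1 \<noteq> e2" "e1 \<notin> E \<union> L" "e2 \<notin> E \<union> L"
    and "v \<in> X" "v \<in> inc e1" "v \<in> inc e2"
  shows "paired_cotree inc X E' L'"
proof -
  obtain T \<phi> where T: "T \<subseteq> E" "connected_on X T inc" "card T + 1 = card X"
    "\<forall>e\<in>(E - T) \<union> L. \<phi> e \<in> inc e \<inter> X" "\<forall>v. even (card {e \<in> (E - T) \<union> L. \<phi> e = v})"
    using assms(1) unfolding paired_cotree_def by blast
  define K where "K = (E - T) \<union> L"
  define \<phi>' where "\<phi>' = \<phi>(e1 := v, e2 := v)"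
  have K': "(E' - T) \<union> L' = insert e1 (insert e2 K)"
    using assms(4-7,9,10) T(1) unfolding K_def by blast
  have new: "e1 \<notin> K" "e2 \<notin> K" using assms(9,10) by (auto simp: K_def)
  have fin: "finite K"
    using assms(2-5) by (auto simp: K_def intro: finite_subset)
  have "even (card {e \<in> insert e1 (insert e2 K). \<phi>' e = x})" for x
  proof (cases "x = v")
    case True
    have "{e \<in> insert e1 (insert e2 K). \<phi>' e = x} = insert e1 (insert e2 {e \<in> K. \<phi> e = x})"
      using True new by (auto simp: \<phi>'_def)
    moreover have "card (insert e1 (insert e2 {e \<in> K. \<phi> e = x})) = card {e \<in> K. \<phi> e = x} + 2"
      using fin new assms(8) by simp
    ultimately show ?thesis using T(5) by (simp add: K_def)
  next
    case False
    then have "{e \<in> insert e1 (insert e2 K). \<phi>' e = x} = {e \<in> K. \<phi> e = x}"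
      using new by (auto simp: \<phi>'_def)
    then show ?thesis using T(5) by (simp add: K_def)
  qed
  moreover have "\<forall>e\<in>insert e1 (insert e2 K). \<phi>' e \<in> inc e \<inter> X"
    using T(4) assms(11-13) by (auto simp: \<phi>'_def K_def)
  moreover have "T \<subseteq> E'" using T(1) assms(4) by blast
  ultimately show ?thesis 
    unfolding paired_cotree_def using T(2,3) by (intro exI[of _ T] exI[of _ \<phi>']) (simp add: K')
qed

lemma paired_cotree_glue:
  assumes mg: "multigraph X E inc" and ep: "edge_partition inc X E P D"
    and TQ: "TQ \<subseteq> E - D" "card TQ + 1 = card P"
    and conn: "\<And>S. \<forall>C\<in>P. connected_on C S inc \<Longrightarrow> connected_on X (S \<union> TQ) inc"
    and \<psi>: "\<And>f. f \<in> E - D \<Longrightarrow> \<psi> f \<in> P"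
    and part: "\<And>C. C \<in> P \<Longrightarrow>
      paired_cotree inc C (induced_edges D inc C) {f \<in> E - D - TQ. \<psi> f = C}"
  shows "paired_cotree inc X E {}"
proof -
  let ?D = "\<lambda>C. induced_edges D inc C" and ?L = "\<lambda>C. {f \<in> E - D - TQ. \<psi> f = C}"
  have parts: "partition_on X P" and sub: "D \<subseteq> E" and inside: "\<forall>e\<in>D. \<exists>C\<in>P. inc e \<subseteq> C"
    using ep by (auto simp: edge_partition_def)
  have finE: "finite E" and finX: "finite X" using mg by (auto simp: multigraph_def)
  have finP: "finite P" using partition_on_finite[OF finX parts] .
  have "\<forall>C\<in>P. \<exists>T \<phi>. T \<subseteq> ?D C \<and> connected_on C T inc \<and> card T + 1 = card C \<and>
       (\<forall>e\<in>(?D C - T) \<union> ?L C. \<phi> e \<in> inc e \<inter> C) \<and>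
       (\<forall>v. even (card {e \<in> (?D C - T) \<union> ?L C. \<phi> e = v}))"
    using part unfolding paired_cotree_def by blast
  from bchoice[OF this] obtain T where
    "\<forall>C\<in>P. \<exists>\<phi>. T C \<subseteq> ?D C \<and> connected_on C (T C) inc \<and> card (T C) + 1 = card C \<and>
       (\<forall>e\<in>(?D C - T C) \<union> ?L C. \<phi> e \<in> inc e \<inter> C) \<and>
       (\<forall>v. even (card {e \<in> (?D C - T C) \<union> ?L C. \<phi> e = v}))"
    by blast
  from bchoice[OF this] obtain \<phi> where
    all: "\<forall>C\<in>P. T C \<subseteq> ?D C \<and> connected_on C (T C) inc \<and> card (T C) + 1 = card C \<and>
       (\<forall>e\<in>(?D C - T C) \<union> ?L C. \<phi> C e \<in> inc e \<inter> C) \<and>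
       (\<forall>v. even (card {e \<in> (?D C - T C) \<union> ?L C. \<phi> C e = v}))"
    by blast
  \<comment> \<open>The sets \<open>M C\<close> are disjoint and make up the complement of the glued
    tree.\<close>
  define M where "M C = (?D C - T C) \<union> ?L C" for C
  have TD: "T C \<subseteq> ?D C" and Tconn: "connected_on C (T C) inc" and Tcard: "card (T C) + 1 = card C"
    and M\<phi>: "\<And>e. e \<in> M C \<Longrightarrow> \<phi> C e \<in> inc e \<inter> C" and Meven: "\<And>v. even (card {e \<in> M C. \<phi> C e = v})"
    if "C \<in> P" for C
    using bspec[OF all that] by (auto simp: M_def)
  have Duniq: "C = C'" if "C \<in> P" "C' \<in> P" "e \<in> ?D C" "e \<in> ?D C'" for C C' e
  proof -
    have "inc e \<noteq> {}" using that(3) sub by (intro multigraph_inc_ne[OF mg]) (auto simp: induced_edges_def)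
    then obtain x where "x \<in> inc e" by blast
    then have "x \<in> C" "x \<in> C'" using that by (auto simp: induced_edges_def)
    then show ?thesis using partition_part[OF parts that(1,2)] by blast
  qed
  have Muniq: "C = C'" if "C \<in> P" "C' \<in> P" "e \<in> M C" "e \<in> M C'" for C C' e
  proof (cases "e \<in> D")
    case True
    then have "e \<in> ?D C" "e \<in> ?D C'" using that by (auto simp: M_def)
    then show ?thesis using Duniq that by blast
  next
    case False
    then show ?thesis using that by (auto simp: M_def induced_edges_def)
  qed
  define TT where "TT = (\<Union>C\<in>P. T C) \<union> TQ"
  have cot: "E - TT = (\<Union>C\<in>P. M C)"
  proof
    show "E - TT \<subseteq> (\<Union>C\<in>P. M C)"
    proof
      fix e assume e: "e \<in> E - TT"
      show "e \<in> (\<Union>C\<in>P. M C)"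
      proof (cases "e \<in> D")
        case True
        then obtain C where "C \<in> P" "inc e \<subseteq> C" using inside by blast
        with True e show ?thesis by (auto simp: TT_def M_def induced_edges_def)
      next
        case False
        then show ?thesis using e \<psi>[of e] by (auto simp: TT_def M_def)
      qed
    qed
    show "(\<Union>C\<in>P. M C) \<subseteq> E - TT"
    proof
      fix e assume "e \<in> (\<Union>C\<in>P. M C)"
      then obtain C where C: "C \<in> P" "e \<in> M C" by blast
      have "e \<notin> T C'" if C': "C' \<in> P" for C'
      proof
        assume e: "e \<in> T C'"
        then have D': "e \<in> ?D C'" using TD[OF C'] by blast
        then have "e \<in> ?D C - T C" using C(2) by (auto simp: M_def induced_edges_def)
        then show False using Duniq[OF C(1) C', of e] D' e by blast
      qed
      then show "e \<in> E - TT"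
        using C sub TQ by (auto simp: TT_def M_def induced_edges_def)
    qed
  qed
  have "\<exists>C\<in>P. e \<in> M C" if "e \<in> E - TT" for e using that cot by blast
  then obtain own where own: "\<And>e. e \<in> E - TT \<Longrightarrow> own e \<in> P \<and> e \<in> M (own e)" by metis
  define \<Phi> where "\<Phi> e = \<phi> (own e) e" for e
  have \<Phi>_eq: "\<Phi> e = \<phi> C e" if "C \<in> P" "e \<in> M C" for C e
  proof -
    have "e \<in> E - TT" using that cot by blast
    then have "own e = C" using own Muniq that by blast
    then show ?thesis by (simp add: \<Phi>_def)
  qed
  have \<Phi>_in: "\<Phi> e \<in> inc e \<inter> own e" if "e \<in> E - TT" for e
    using own[OF that] M\<phi> \<Phi>_eq by metis
  have ownX: "own e \<subseteq> X" if "e \<in> E - TT" for e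
    using own[OF that] partition_onD1[OF parts] by blast
  have TE: "T C \<subseteq> E" if "C \<in> P" for C using TD[OF that] sub by (auto simp: induced_edges_def)
  have "TT \<subseteq> E" using TE TQ(1) by (auto simp: TT_def)
  moreover have "connected_on X TT inc"
    unfolding TT_def
  proof (rule conn, rule ballI)
    fix C assume C: "C \<in> P"
    show "connected_on C (\<Union>C\<in>P. T C) inc"
      using Tconn[OF C] C reach_mono[of "T C" inc _ _ "\<Union>C\<in>P. T C"] unfolding connected_on_def
      by blast
  qed
  moreover have "card TT + 1 = card X"
  proof -
    have finT: "finite (T C)" if "C \<in> P" for C
      using TE[OF that] finE by (rule finite_subset)
    have "T C \<inter> TQ = {}" if "C \<in> P" for C
      using TD[OF that] TQ(1) by (auto simp: induced_edges_def)
    then have "(\<Union>C\<in>P. T C) \<inter> TQ = {}" by blast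
    moreover have "finite (\<Union>C\<in>P. T C)" "finite TQ"
      using finT finP TQ(1) finE by (auto intro: finite_subset)
    ultimately have "card TT = card (\<Union>C\<in>P. T C) + card TQ"
      unfolding TT_def by (simp add: card_Un_disjoint)
    moreover have "card (\<Union>C\<in>P. T C) = (\<Sum>C\<in>P. card (T C))"
      using finP finT Duniq TD by (intro card_UN_disjoint) blast+
    moreover have "(\<Sum>C\<in>P. card (T C)) + card P = card X"
    proof -
      have "(\<Sum>C\<in>P. card (T C)) + card P = (\<Sum>C\<in>P. card (T C) + 1)"
        unfolding sum.distrib by simp
      also have "\<dots> = (\<Sum>C\<in>P. card C)" using Tcard by (intro sum.cong) auto
      finally show ?thesis using sum_card_parts[OF finX parts] by simp
    qed
    ultimately show ?thesis using TQ(2) by linarith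
  qed
  moreover have "\<forall>e\<in>E - TT. \<Phi> e \<in> inc e \<inter> X" using \<Phi>_in ownX by blast
  moreover have "even (card {e \<in> E - TT. \<Phi> e = v})" for v
  proof (cases "v \<in> X")
    case True
    then obtain C where C: "C \<in> P" "v \<in> C" using partition_onD1[OF parts] by blast
    have "{e \<in> E - TT. \<Phi> e = v} = {e \<in> M C. \<phi> C e = v}"
    proof (intro set_eqI iffI)
      fix e assume e: "e \<in> {e \<in> E - TT. \<Phi> e = v}"
      then have "v \<in> own e" using \<Phi>_in[of e] by auto
      then have "own e = C" using partition_part[OF parts _ C(1)] own[of e] e C(2) by blast
      then show "e \<in> {e \<in> M C. \<phi> C e = v}" using own[of e] e by (auto simp: \<Phi>_def)
    next
      fix e assume e: "e \<in> {e \<in> M C. \<phi> C e = v}"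
      then show "e \<in> {e \<in> E - TT. \<Phi> e = v}" using \<Phi>_eq[OF C(1), of e] cot C(1) by auto
    qed
    then show ?thesis using Meven[OF C(1)] by simp
  next
    case False
    then have "{e \<in> E - TT. \<Phi> e = v} = {}" using \<Phi>_in ownX by blast
    then show ?thesis by (simp only: card.empty even_zero)
  qed
  ultimately show ?thesis
    unfolding paired_cotree_def by (intro exI[of _ TT] exI[of _ \<Phi>]) simp
qed

section \<open>The induction from Nebesky's condition to a paired cotree\<close>

text \<open>Choosing one end of each of the disjoint edges is injective, so
  \<open>card E \<le> card X\<close>. The partition into singletons with \<open>D\<close> empty
  weighs at least \<open>card X\<close>, which contradicts \<open>gap\<close> unless
  \<open>X\<close> is a single vertex and \<open>E\<close> is empty.\<close>

lemma nebesky_no_adjacent_edges: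
  assumes mg: "multigraph X E inc" and "X \<noteq> {}"
    and adj: "\<And>e1 e2. e1 \<in> E \<Longrightarrow> e2 \<in> E \<Longrightarrow> e1 \<noteq> e2 \<Longrightarrow> inc e1 \<inter> inc e2 = {}"
    and gap: "\<And>P D. edge_partition inc X E P D \<Longrightarrow> card (E - D) + card P > 1 \<Longrightarrow>
      (\<Sum>C\<in>P. weight inc D C) + 1 \<le> card (E - D)"
  shows "paired_cotree inc X E {}"
proof -
  have fin: "finite X" "finite E" using mg by (auto simp: multigraph_def)
  define P where "P = (\<lambda>x. {x}) ` X"
  have cardP: "card P = card X" unfolding P_def by (intro card_image) (auto simp: inj_on_def)
  have ep: "edge_partition inc X E P {}"
    unfolding edge_partition_def P_def by (simp add: partition_on_singletons)
  have "\<forall>e\<in>E. \<exists>x. x \<in> inc e" using multigraph_inc_ne[OF mg] by blast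
  then obtain pick where pick: "\<And>e. e \<in> E \<Longrightarrow> pick e \<in> inc e" by metis
  have "inj_on pick E" using pick adj by (intro inj_onI) (metis disjoint_iff)
  moreover have "pick ` E \<subseteq> X" using pick mg by (auto simp: multigraph_def)
  ultimately have "card E \<le> card X" using fin by (simp add: card_inj_on_le)
  moreover have "card P \<le> (\<Sum>C\<in>P. weight inc {} C)" by (rule card_parts_le_sum_weight)
  ultimately have "\<not> card E + card X > 1" using gap[OF ep] cardP by auto
  moreover have "card X \<ge> 1" using fin(1) \<open>X \<noteq> {}\<close> by (simp add: Suc_le_eq card_gt_0_iff)
  ultimately have "card E = 0" "card X = 1" by linarith+
  then have "E = {}" using fin by simp
  obtain x where "X = {x}" using \<open>card X = 1\<close> card_1_singletonE by blast
  then show ?thesis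
    unfolding paired_cotree_def using \<open>E = {}\<close>
    by (intro exI[of _ "{}"] exI) (auto simp: connected_on_def reach.refl)
qed

text \<open>In a tight pair \<open>(P, D)\<close> the edges outside \<open>D\<close> are oriented so that every part \<open>C\<close> other than
  \<open>R\<close> gets in-degree \<open>weight C\<close>, and \<open>R\<close> gets one less. One entering edge per part yields a tree on
  the parts; what remains is a single entering edge for each part of weight 2.\<close>

lemma tight_tree_on_parts:
  assumes mg: "multigraph X E inc" and neb: "nebesky inc X E"
    and ep: "edge_partition inc X E P D"
    and tight: "(\<Sum>C\<in>P. weight inc D C) = card (E - D) + 1"
  shows "\<exists>TQ \<psi>. TQ \<subseteq> E - D \<and> card TQ + 1 = card P \<and>
    (\<forall>S. (\<forall>C\<in>P. connected_on C S inc) \<longrightarrow> connected_on X (S \<union> TQ) inc) \<and>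
    (\<forall>f\<in>E - D. \<psi> f \<in> P \<and> inc f \<inter> \<psi> f \<noteq> {}) \<and>
    (\<forall>C\<in>P. card {f \<in> E - D - TQ. \<psi> f = C} + 1 = weight inc D C)"
proof -
  define F where "F = E - D"
  define N where "N f = {C \<in> P. inc f \<inter> C \<noteq> {}}" for f
  have parts: "partition_on X P" using ep by (simp add: edge_partition_def)
  have UP: "\<Union>P = X" using partition_onD1[OF parts] by simp
  have fin: "finite X" "finite F" using mg by (auto simp: multigraph_def F_def)
  have finP: "finite P" using partition_on_finite[OF fin(1) parts] .
  have "P \<noteq> {}" using tight by auto
  then obtain R where R: "R \<in> P" by blast
  define d where "d C = weight inc D C - (if C = R then 1 else 0)" for C
  have incX: "inc f \<subseteq> X" if "f \<in> F" for f using mg that by (auto simp: multigraph_def F_def)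
  have N_iff: "N f \<subseteq> Y \<longleftrightarrow> inc f \<subseteq> \<Union>Y" if f: "f \<in> F" and Y: "Y \<subseteq> P" for f Y
  proof
    assume N: "N f \<subseteq> Y"
    show "inc f \<subseteq> \<Union>Y"
    proof
      fix x assume x: "x \<in> inc f"
      then obtain C where "C \<in> P" "x \<in> C" using incX[OF f] UP by blast
      with x N show "x \<in> \<Union>Y" by (auto simp: N_def)
    qed
  next
    assume sub: "inc f \<subseteq> \<Union>Y"
    show "N f \<subseteq> Y"
    proof
      fix C assume "C \<in> N f"
      then obtain x where x: "C \<in> P" "x \<in> inc f" "x \<in> C" by (auto simp: N_def)
      then obtain C' where C': "C' \<in> Y" "x \<in> C'" using sub by blast
      then have "C = C'" using partition_part[OF parts x(1) _ x(3)] Y by blast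
      with C' show "C \<in> Y" by simp
    qed
  qed
  have sum_d: "(\<Sum>C\<in>Y. d C) + (if R \<in> Y then 1 else 0) = (\<Sum>C\<in>Y. weight inc D C)"
    if "Y \<subseteq> P" for Y
  proof -
    have finY: "finite Y" using that finP by (rule finite_subset)
    have "d C + (if C = R then 1 else 0) = weight inc D C" for C
      using weight_pos[of inc D C] by (auto simp: d_def)
    then have "(\<Sum>C\<in>Y. weight inc D C) = (\<Sum>C\<in>Y. d C + (if C = R then 1 else 0))" by simp
    also have "\<dots> = (\<Sum>C\<in>Y. d C) + (if R \<in> Y then 1 else 0)"
      using finY by (simp add: sum.distrib)
    finally show ?thesis by simp
  qed
  have inside: "card {f \<in> F. inc f \<subseteq> \<Union>Y} + 1 \<le> (\<Sum>C\<in>Y. weight inc D C)"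
    if "Y \<subseteq> P" "Y \<noteq> {}" for Y
    using merge_parts[OF mg neb ep tight that] by (simp add: F_def)
  have "\<exists>\<psi>. (\<forall>f\<in>F. \<psi> f \<in> N f) \<and> (\<forall>C\<in>P. card {f \<in> F. \<psi> f = C} = d C)"
  proof (rule exact_choice[OF finP fin(2)])
    show "N f \<subseteq> P" for f by (auto simp: N_def)
    show "card F = sum d P" using sum_d[of P] R tight by (simp add: F_def)
    show "card {f \<in> F. N f \<subseteq> Y} \<le> sum d Y" if Y: "Y \<subseteq> P" for Y
    proof (cases "Y = {}")
      case True
      have "inc f \<noteq> {}" if "f \<in> F" for f using multigraph_inc_ne[OF mg] that by (auto simp: F_def)
      then have "{f \<in> F. N f \<subseteq> Y} = {}" using N_iff[of _ "{}"] True by auto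
      then show ?thesis by (simp only: card.empty le0)
    next
      case False
      have "{f \<in> F. N f \<subseteq> Y} = {f \<in> F. inc f \<subseteq> \<Union>Y}" using N_iff Y by blast
      then show ?thesis using inside[OF Y False] sum_d[OF Y] by (auto split: if_splits)
    qed
  qed
  then obtain \<psi> where \<psi>: "\<And>f. f \<in> F \<Longrightarrow> \<psi> f \<in> N f"
    and \<psi>_card: "\<And>C. C \<in> P \<Longrightarrow> card {f \<in> F. \<psi> f = C} = d C"
    by blast
  have "\<exists>TQ\<subseteq>F. (\<forall>S. (\<forall>C\<in>P. connected_on C S inc) \<longrightarrow> connected_on X (S \<union> TQ) inc) \<and>
      (\<forall>C\<in>P. card {f \<in> TQ. \<psi> f = C} = (if C = R then 0 else 1))"
  proof (rule connected_parts_tree[OF parts finP R])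
    fix Y assume Y: "Y \<subseteq> P" "Y \<noteq> {}" "R \<notin> Y"
    have finY: "finite Y" using Y(1) finP by (rule finite_subset)
    \<comment> \<open>Otherwise all edges oriented into \<open>Y\<close> lie inside its union. As
      \<open>R\<close> is not in \<open>Y\<close>, their number is the full weight of
      \<open>Y\<close>, which exceeds the number of edges inside.\<close>
    have "\<exists>f\<in>F. \<psi> f \<in> Y \<and> \<not> inc f \<subseteq> \<Union>Y"
    proof (rule ccontr)
      assume "\<not> ?thesis"
      then have "{f \<in> F. \<psi> f \<in> Y} \<subseteq> {f \<in> F. inc f \<subseteq> \<Union>Y}" by blast
      then have "card {f \<in> F. \<psi> f \<in> Y} \<le> card {f \<in> F. inc f \<subseteq> \<Union>Y}"
        using fin(2) by (intro card_mono) auto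
      moreover have "card {f \<in> F. \<psi> f \<in> Y} = (\<Sum>C\<in>Y. d C)"
        using sum_card_fibres[OF finY fin(2), of \<psi>] \<psi>_card Y(1) by (simp add: subset_iff)
      ultimately show False using inside[OF Y(1,2)] sum_d[OF Y(1)] Y(3) by simp
    qed
    then obtain f b where f: "f \<in> F" "\<psi> f \<in> Y" "b \<in> inc f" "b \<notin> \<Union>Y" by blast
    obtain a where a: "a \<in> inc f" "a \<in> \<psi> f" using \<psi>[OF f(1)] by (auto simp: N_def)
    have "a \<noteq> b" using a f by blast
    moreover have "card (inc f) = 1 \<or> card (inc f) = 2"
      using mg f(1) by (auto simp: multigraph_def F_def)
    ultimately have "inc f = {a, b}"
      using a(1) f(3) by (auto simp: card_1_singleton_iff card_2_iff)
    then show "\<exists>f\<in>F. \<exists>a b. inc f = {a, b} \<and> \<psi> f \<in> Y \<and> a \<in> \<psi> f \<and> b \<in> X \<and> b \<notin> \<Union>Y"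
      using f a incX[OF f(1)] by blast
  qed
  then obtain TQ where TQ: "TQ \<subseteq> F"
    "\<forall>S. (\<forall>C\<in>P. connected_on C S inc) \<longrightarrow> connected_on X (S \<union> TQ) inc"
    "\<And>C. C \<in> P \<Longrightarrow> card {f \<in> TQ. \<psi> f = C} = (if C = R then 0 else 1)"
    by blast
  have finTQ: "finite TQ" using TQ(1) fin(2) by (rule finite_subset)
  show ?thesis
  proof (intro exI[of _ TQ] exI[of _ \<psi>] conjI TQ(2) ballI)
    show "TQ \<subseteq> E - D" using TQ(1) by (simp add: F_def)
    show "\<psi> f \<in> P" "inc f \<inter> \<psi> f \<noteq> {}" if "f \<in> E - D" for f
      using \<psi>[of f] that by (auto simp: F_def N_def)
    have "{f \<in> TQ. \<psi> f \<in> P} = TQ" using \<psi> TQ(1) by (auto simp: N_def)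
    then have "card TQ = (\<Sum>C\<in>P. card {f \<in> TQ. \<psi> f = C})"
      using sum_card_fibres[OF finP finTQ, of \<psi>] by simp
    also have "\<dots> = (\<Sum>C\<in>P. if C = R then 0 else 1)" using TQ(3) by simp
    also have "\<dots> + 1 = (\<Sum>C\<in>P. (if C = R then 0 else 1) + (if C = R then 1 else 0))"
      using finP R by (simp add: sum.distrib)
    also have "\<dots> = (\<Sum>C\<in>P. 1)" by (intro sum.cong) auto
    finally show "card TQ + 1 = card P" by simp
    show "card {f \<in> E - D - TQ. \<psi> f = C} + 1 = weight inc D C" if C: "C \<in> P" for C
    proof -
      have "{f \<in> E - D - TQ. \<psi> f = C} = {f \<in> F. \<psi> f = C} - {f \<in> TQ. \<psi> f = C}"
        by (auto simp: F_def)
      moreover have "card ({f \<in> F. \<psi> f = C} - {f \<in> TQ. \<psi> f = C}) =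
          card {f \<in> F. \<psi> f = C} - card {f \<in> TQ. \<psi> f = C}"
        using finTQ TQ(1) by (intro card_Diff_subset) auto
      ultimately show ?thesis
        using \<psi>_card[OF C] TQ(3)[OF C] weight_pos[of inc D C] by (auto simp: d_def split: if_splits)
    qed
  qed
qed

text \<open>Among the tight pairs \<open>(P, D)\<close> one with as many parts and as few edges in \<open>D\<close> as possible is
  chosen. Then any proper refinement fails to be tight by at least 2, so the induction hypothesis
  applies to every part of weight 1, and to every part of weight 2 after deleting an arbitrary edge.\<close>

lemma nebesky_imp_paired_cotree:
  assumes "multigraph X E inc" "X \<noteq> {}" "nebesky inc X E"
  shows "paired_cotree inc X E {}"
  using assms
proof (induction "card E" arbitrary: X E rule: less_induct)
  case less
  note mg = less.prems(1) and neb = less.prems(3)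
  have fin: "finite X" "finite E" using mg by (auto simp: multigraph_def)
  define tight where "tight p \<longleftrightarrow> edge_partition inc X E (fst p) (snd p) \<and>
      (\<Sum>C\<in>fst p. weight inc (snd p) C) = card (E - snd p) + 1" for p
  define rank where "rank p = card (E - snd p) + card (fst p)" for p :: "'a set set \<times> 'b set"
  have epX: "edge_partition inc X E {X} E"
    using less.prems mg by (auto simp: edge_partition_def multigraph_def partition_on_space)
  \<comment> \<open>The trivial pair is tight. Hence a tight pair of greatest rank exists, and
    \<open>card E + card X\<close> is odd.\<close>
  have "weight inc E X \<le> 1" using neb epX unfolding nebesky_def by fastforce
  then have wX: "weight inc E X = 1" using weight_pos[of inc E X] by simp
  have "tight ({X}, E)" using epX wX by (simp add: tight_def)
  moreover have "rank p \<le> card E + card X" if "tight p" for p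
  proof -
    have parts: "partition_on X (fst p)" using that by (simp add: tight_def edge_partition_def)
    have "card (fst p) \<le> (\<Sum>C\<in>fst p. card C)"
    proof -
      have "(\<Sum>C\<in>fst p. 1) \<le> (\<Sum>C\<in>fst p. card C)"
      proof (rule sum_mono)
        fix C assume "C \<in> fst p"
        then have "C \<noteq> {}" "C \<subseteq> X" using parts by (auto simp: partition_on_def)
        then show "1 \<le> card C" using fin(1) by (simp add: Suc_le_eq card_gt_0_iff finite_subset)
      qed
      then show ?thesis by simp
    qed
    then have "card (fst p) \<le> card X" using sum_card_parts[OF fin(1) parts] by simp
    moreover have "card (E - snd p) \<le> card E" using fin(2) by (intro card_mono) auto
    ultimately show ?thesis by (simp add: rank_def)
  qed
  ultimately have "\<exists>p. tight p \<and> (\<forall>q. tight q \<longrightarrow> rank q \<le> rank p)"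
    using ex_has_greatest_nat[of tight "({X}, E)" rank "card E + card X + 1"]
    by (simp add: less_Suc_eq_le del: split_paired_All split_paired_Ex)
  then obtain p where p: "tight p" "\<And>q. tight q \<Longrightarrow> rank q \<le> rank p" by blast
  define P D where "P = fst p" and "D = snd p"
  have ep: "edge_partition inc X E P D" and
    tight: "(\<Sum>C\<in>P. weight inc D C) = card (E - D) + 1"
    using p(1) by (auto simp: tight_def P_def D_def)
  have parts: "partition_on X P" and sub: "D \<subseteq> E" using ep by (auto simp: edge_partition_def)
  have finP: "finite P" using partition_on_finite[OF fin(1) parts] .
  \<comment> \<open>Both sides of Nebesky's inequality have equal parity, so a pair that is not
    tight falls short by at least 2. This gives \<open>gap\<close> for all pairs of larger
    rank.\<close>
  have parity: "even (\<Sum>C\<in>P'. weight inc D' C) \<longleftrightarrow> even (card (E - D') + 1)"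
    if "edge_partition inc X E P' D'" for P' D'
  proof -
    have "D' \<subseteq> E" using that by (simp add: edge_partition_def)
    then have "card (E - D') + card D' = card E"
      using fin(2) by (metis card_Diff_subset card_mono finite_subset le_add_diff_inverse2)
    moreover have "odd (card E + card X)"
      using even_sum_weight_iff[OF mg epX] wX by simp
    ultimately show ?thesis using even_sum_weight_iff[OF mg that]
      by (metis even_add even_plus_one_iff)
  qed
  have gap: "(\<Sum>C\<in>P'. weight inc D' C) + 1 \<le> card (E - D')"
    if "edge_partition inc X E P' D'" "card (E - D') + card P' > card (E - D) + card P" for P' D'
  proof -
    have "\<not> tight (P', D')" using p(2)[of "(P', D')"] that(2) by (auto simp: rank_def P_def D_def)
    then have "(\<Sum>C\<in>P'. weight inc D' C) \<noteq> card (E - D') + 1" using that(1) by (simp add: tight_def)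
    moreover have "(\<Sum>C\<in>P'. weight inc D' C) \<le> card (E - D') + 1"
      using neb that(1) by (simp add: nebesky_def)
    moreover have "(\<Sum>C\<in>P'. weight inc D' C) \<noteq> card (E - D')"
      using parity[OF that(1)] by auto
    ultimately show ?thesis by linarith
  qed
  show ?case
  proof (cases "D = E")
    \<comment> \<open>Here \<open>P\<close> consists of \<open>X\<close> alone, so
      \<open>gap\<close> applies to every other pair. Two adjacent edges can then be deleted and
      paired with each other, the loss of 2 being covered by the gap; if no two edges meet, the
      graph is trivial.\<close>
    case True
    have "card P \<le> 1" using tight True card_parts_le_sum_weight[of P inc D] by simp
    then have rank1: "card (E - D) + card P \<le> 1" using True by simp
    show ?thesis
    proof (cases "\<exists>e1\<in>E. \<exists>e2\<in>E. e1 \<noteq> e2 \<and> inc e1 \<inter> inc e2 \<noteq> {}")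
      case True
      then obtain e1 e2 v where e: "e1 \<in> E" "e2 \<in> E" "e1 \<noteq> e2" "v \<in> inc e1" "v \<in> inc e2"
        by blast
      define E' where "E' = E - {e1, e2}"
      have "nebesky inc X E'"
        unfolding nebesky_def
      proof (intro allI impI)
        fix P' D' assume ep': "edge_partition inc X E' P' D'"
        then have D': "D' \<subseteq> E'" by (simp add: edge_partition_def)
        have epE: "edge_partition inc X E P' D'"
          using ep' by (auto simp: edge_partition_def E'_def)
        have "E - D' = insert e1 (insert e2 (E' - D'))" using D' e by (auto simp: E'_def)
        moreover have "e1 \<notin> insert e2 (E' - D')" "e2 \<notin> E' - D'" using e by (auto simp: E'_def)
        ultimately have c: "card (E - D') = card (E' - D') + 2"
          using fin(2) by (simp add: E'_def)
        then have "(\<Sum>C\<in>P'. weight inc D' C) + 1 \<le> card (E - D')"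
          using gap[OF epE] rank1 by simp
        with c show "(\<Sum>C\<in>P'. weight inc D' C) \<le> card (E' - D') + 1" by simp
      qed
      moreover have "card E' < card E"
        unfolding E'_def using e fin(2) by (intro psubset_card_mono) auto
      moreover have "multigraph X E' inc" using mg by (rule multigraph_mono) (auto simp: E'_def)
      ultimately have "paired_cotree inc X E' {}" using less.hyps less.prems(2) by blast
      moreover have "v \<in> X" using mg e by (auto simp: multigraph_def)
      ultimately show ?thesis
        using e fin(2)
        by (intro paired_cotree_add_pair[of inc X E' "{}" E "{}" e1 e2 v]) (auto simp: E'_def)
    next
      case False
      show ?thesis
      proof (rule nebesky_no_adjacent_edges[OF mg less.prems(2)])
        show "inc e1 \<inter> inc e2 = {}" if "e1 \<in> E" "e2 \<in> E" "e1 \<noteq> e2" for e1 e2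
          using False that by blast
        show "(\<Sum>C\<in>P'. weight inc D' C) + 1 \<le> card (E - D')"
          if "edge_partition inc X E P' D'" "card (E - D') + card P' > 1" for P' D'
          using gap[OF that(1)] that(2) rank1 by linarith
      qed
    qed
  next
    case False
    then have "card D < card E" using sub fin(2) by (intro psubset_card_mono) auto
    from tight_tree_on_parts[OF mg neb ep tight] obtain TQ \<psi>
      where TQ: "TQ \<subseteq> E - D" "card TQ + 1 = card P"
        "\<forall>S. (\<forall>C\<in>P. connected_on C S inc) \<longrightarrow> connected_on X (S \<union> TQ) inc"
      and \<psi>: "\<forall>f\<in>E - D. \<psi> f \<in> P \<and> inc f \<inter> \<psi> f \<noteq> {}"
      and left: "\<forall>C\<in>P. card {f \<in> E - D - TQ. \<psi> f = C} + 1 = weight inc D C"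
      by (elim exE conjE)
    have "paired_cotree inc C (induced_edges D inc C) {f \<in> E - D - TQ. \<psi> f = C}"
      if C: "C \<in> P" for C
    proof -
      let ?D = "induced_edges D inc C" and ?L = "{f \<in> E - D - TQ. \<psi> f = C}"
      have CX: "C \<subseteq> X" "C \<noteq> {}" using parts C by (auto simp: partition_on_def)
      have mgC: "multigraph C ?D inc"
        using multigraph_induced[OF multigraph_mono[OF mg sub] CX(1)] .
      have finD: "finite ?D" using mgC by (simp add: multigraph_def)
      have "card ?D \<le> card D"
        using sub fin(2) by (intro card_mono) (auto simp: induced_edges_def intro: finite_subset)
      then have small: "card ?D < card E" using \<open>card D < card E\<close> by simp
      have basic: "(\<Sum>B\<in>Q. weight inc D1 B) \<le> weight inc D C + card (?D - D1)"
        if Q: "edge_partition inc C ?D Q D1" for Q D1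
      proof -
        have "(\<Sum>B\<in>(P - {C}) \<union> Q. weight inc ((D - ?D) \<union> D1) B) \<le> card (E - ((D - ?D) \<union> D1)) + 1"
          using neb refine_part(1)[OF mg ep C Q] by (simp add: nebesky_def)
        then show ?thesis
          using refine_part(2,3)[OF mg ep C Q] tight by linarith
      qed
      \<comment> \<open>A proper refinement of \<open>C\<close> yields a pair of larger rank on
        \<open>X\<close>, so the slack of 2 passes to the part.\<close>
      have strict: "(\<Sum>B\<in>Q. weight inc D1 B) + 2 \<le> weight inc D C + card (?D - D1)"
        if Q: "edge_partition inc C ?D Q D1" and big: "D1 \<noteq> ?D \<or> card Q > 1" for Q D1
      proof -
        have D1: "D1 \<subseteq> ?D" and Q1: "partition_on C Q" using Q by (auto simp: edge_partition_def)
        have "Q \<noteq> {}" using partition_onD1[OF Q1] CX(2) by auto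
        moreover have "finite C" using CX(1) fin(1) by (rule finite_subset)
        ultimately have "card Q \<ge> 1"
          using partition_on_finite[OF _ Q1] by (simp add: Suc_le_eq card_gt_0_iff)
        moreover have "card (?D - D1) \<ge> 1" if "D1 \<noteq> ?D"
          using that D1 finD by (auto simp: Suc_le_eq card_gt_0_iff)
        ultimately have "card (?D - D1) + card Q > 1" using big by linarith
        then have "(\<Sum>B\<in>(P - {C}) \<union> Q. weight inc ((D - ?D) \<union> D1) B) + 1
            \<le> card (E - ((D - ?D) \<union> D1))"
          using refine_part(3,4)[OF mg ep C Q] by (intro gap[OF refine_part(1)[OF mg ep C Q]]) linarith
        then show ?thesis
          using refine_part(2,3)[OF mg ep C Q] tight by linarith
      qed
      show ?thesis
      proof (cases "weight inc D C = 1")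
        case True
        then have "nebesky inc C ?D" unfolding nebesky_def using basic by fastforce
        then have "paired_cotree inc C ?D {}" using less.hyps[OF small mgC CX(2)] by blast
        moreover have "?L = {}" using bspec[OF left C] True fin(2) by auto
        ultimately show ?thesis by (simp only:)
      next
        case False
        then have w2: "weight inc D C = 2" by (simp add: weight_def split: if_splits)
        then have "card ?L = 1" using bspec[OF left C] by simp
        then obtain f where f: "?L = {f}" by (rule card_1_singletonE)
        then have "f \<in> E - D" "\<psi> f = C" by auto
        then obtain u where u: "u \<in> inc f" "u \<in> C" using \<psi> by blast
        \<comment> \<open>A partner for \<open>f\<close> at \<open>u\<close>: if
          \<open>C = {u}\<close>, weight 2 forces an odd number of edges, hence a loop. Otherwise,
          if no edge met \<open>u\<close>, splitting off \<open>u\<close> would refine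
          \<open>C\<close> without losing an edge, against \<open>strict\<close>.\<close>
        have "\<exists>e\<in>?D. u \<in> inc e"
        proof (cases "C = {u}")
          case True
          then have "even (card ?D + 1)" using w2 by (simp add: weight_def split: if_splits)
          then have "?D \<noteq> {}" by auto
          then obtain e where e: "e \<in> ?D" by blast
          then have "inc e \<noteq> {}" "inc e \<subseteq> {u}"
            using multigraph_inc_ne[OF mgC] True by (auto simp: induced_edges_def)
          with e show ?thesis by blast
        next
          case ne: False
          show ?thesis
          proof (rule ccontr)
            assume no: "\<not> ?thesis"
            let ?Q = "{{u}, C - {u}}"
            have cardQ: "card ?Q = 2" using u(2) by (simp add: card_2_iff) blast
            have "partition_on C ?Q"
              using u(2) ne by (auto simp: partition_on_def disjoint_def)
            moreover have "inc e \<subseteq> C - {u}" if "e \<in> ?D" for e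
              using no that by (auto simp: induced_edges_def)
            ultimately have "edge_partition inc C ?D ?Q ?D" by (simp add: edge_partition_def)
            from strict[OF this] cardQ w2 have "weight inc ?D {u} = 0" by simp
            then show False using weight_pos[of inc ?D "{u}"] by simp
          qed
        qed
        then obtain e where e: "e \<in> ?D" "u \<in> inc e" by blast
        \<comment> \<open>For weight 2 the slack in \<open>strict\<close> leaves room for the
          deletion of \<open>e\<close>, which is then paired with \<open>f\<close> at
          \<open>u\<close>.\<close>
        define D2 where "D2 = ?D - {e}"
        have "nebesky inc C D2"
          unfolding nebesky_def
        proof (intro allI impI)
          fix Q D1 assume ep2: "edge_partition inc C D2 Q D1"
          then have D1: "D1 \<subseteq> D2" by (simp add: edge_partition_def)
          have "edge_partition inc C ?D Q D1"
            using ep2 by (auto simp: edge_partition_def D2_def)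
          moreover have "D1 \<noteq> ?D" using D1 e(1) by (auto simp: D2_def)
          ultimately have "(\<Sum>B\<in>Q. weight inc D1 B) + 2 \<le> 2 + card (?D - D1)"
            using strict w2 by fastforce
          moreover have "?D - D1 = insert e (D2 - D1)" using D1 e(1) by (auto simp: D2_def)
          then have "card (?D - D1) = card (D2 - D1) + 1" using finD by (simp add: D2_def)
          ultimately show "(\<Sum>B\<in>Q. weight inc D1 B) \<le> card (D2 - D1) + 1" by simp
        qed
        moreover have "multigraph C D2 inc" using mgC by (rule multigraph_mono) (auto simp: D2_def)
        moreover have "card D2 < card E"
          using small finD e(1) by (simp add: D2_def card_Diff_singleton)
        ultimately have "paired_cotree inc C D2 {}" using less.hyps CX(2) by blast
        moreover have "f \<notin> ?D" using f by (auto simp: induced_edges_def)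
        ultimately show ?thesis
          unfolding f using e u finD
          by (intro paired_cotree_add_pair[of inc C D2 "{}" ?D "{f}" e f u]) (auto simp: D2_def)
      qed
    qed
    then show ?thesis
      using TQ(3) \<psi> by (intro paired_cotree_glue[OF mg ep TQ(1,2), of \<psi>]) blast+
  qed
qed

section \<open>Cyclically 4-edge-connected cubic graphs\<close>

definition crossing :: "'e set \<Rightarrow> ('e \<Rightarrow> 'a set) \<Rightarrow> 'a set \<Rightarrow> 'e set" where
  "crossing E inc C = {e \<in> E. inc e \<inter> C \<noteq> {} \<and> \<not> inc e \<subseteq> C}"

text \<open>Double counting of edge ends in \<open>C\<close>: a loop adds 2 to the degree of its
  vertex, like an edge with both ends in \<open>C\<close>.\<close>

lemma sum_degree:
  assumes mg: "multigraph V E inc" and "C \<subseteq> V"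
  shows "(\<Sum>v\<in>C. degree E inc v) = 2 * card (induced_edges E inc C) + card (crossing E inc C)"
proof -
  have finE: "finite E" and finC: "finite C"
    using assms by (auto simp: multigraph_def intro: finite_subset)
  let ?h = "\<lambda>v e. (if v \<in> inc e \<and> card (inc e) = 2 then 1 else 0) + (if inc e = {v} then 2 else 0) :: nat"
  have ind: "(\<Sum>e\<in>E. if Q e then k else 0) = k * card {e \<in> E. Q e}" for Q and k :: nat
    using finE by (simp add: sum.If_cases Int_def)
  have "degree E inc v = (\<Sum>e\<in>E. ?h v e)" for v
    unfolding degree_def sum.distrib ind by simp
  then have "(\<Sum>v\<in>C. degree E inc v) = (\<Sum>e\<in>E. \<Sum>v\<in>C. ?h v e)"
    by (simp add: sum.swap[of _ C E])
  also have "\<dots> = (\<Sum>e\<in>E. (if inc e \<subseteq> C then 2 else 0) +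
      (if inc e \<inter> C \<noteq> {} \<and> \<not> inc e \<subseteq> C then 1 else 0))"
  proof (rule sum.cong[OF HOL.refl])
    fix e assume "e \<in> E"
    then consider "card (inc e) = 1" | "card (inc e) = 2" using mg by (auto simp: multigraph_def)
    then show "(\<Sum>v\<in>C. ?h v e) =
        (if inc e \<subseteq> C then 2 else 0) + (if inc e \<inter> C \<noteq> {} \<and> \<not> inc e \<subseteq> C then 1 else 0)"
    proof cases
      case 1
      then obtain x where x: "inc e = {x}" by (rule card_1_singletonE)
      have "(\<Sum>v\<in>C. ?h v e) = (\<Sum>v\<in>C. if v = x then 2 else 0)"
        by (intro sum.cong) (auto simp: x)
      also have "\<dots> = (if x \<in> C then 2 else 0)" using finC by simp
      finally show ?thesis by (simp add: x)
    next
      case 2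
      then obtain x y where xy: "inc e = {x, y}" "x \<noteq> y" by (auto simp: card_2_iff)
      have "(\<Sum>v\<in>C. ?h v e) = (\<Sum>v\<in>C. (if v = x then 1 else 0) + (if v = y then 1 else 0))"
        using xy by (intro sum.cong) auto
      also have "\<dots> = (if x \<in> C then 1 else 0) + (if y \<in> C then 1 else 0)"
        using finC by (simp add: sum.distrib)
      finally show ?thesis by (simp add: xy)
    qed
  qed
  also have "\<dots> = 2 * card (induced_edges E inc C) + card (crossing E inc C)"
    unfolding sum.distrib ind by (simp add: induced_edges_def crossing_def)
  finally show ?thesis .
qed

lemma cubic_card:
  assumes "cubic V E inc" and "C \<subseteq> V"
  shows "3 * card C = 2 * card (induced_edges E inc C) + card (crossing E inc C)"
proof -
  have "(\<Sum>v\<in>C. degree E inc v) = (\<Sum>v\<in>C. 3)"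
    using assms by (intro sum.cong) (auto simp: cubic_def)
  then show ?thesis using sum_degree[of V E inc C] assms by (simp add: cubic_def)
qed

lemma crossing_compl:
  assumes "multigraph V E inc" and "C \<subseteq> V"
  shows "crossing E inc (V - C) = crossing E inc C"
proof -
  have "(inc e \<inter> (V - C) \<noteq> {} \<and> \<not> inc e \<subseteq> V - C) \<longleftrightarrow> (inc e \<inter> C \<noteq> {} \<and> \<not> inc e \<subseteq> C)"
    if "e \<in> E" for e
  proof -
    have "inc e \<subseteq> V" using assms(1) that by (simp add: multigraph_def)
    then show ?thesis using assms(2) by blast
  qed
  then show ?thesis unfolding crossing_def by blast
qed

text \<open>A cycle lies within one component. This brings a cycle found in a vertex set into the
  form used by \<open>cycle_separating\<close>.\<close>

lemma has_cycle_component: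
  assumes "has_cycle C F inc" "F \<subseteq> F'" "C \<subseteq> V"
  shows "\<exists>x\<in>C. has_cycle (component V F' inc x) F' inc"
proof -
  obtain vs es where c: "length vs = length es" "length es \<ge> 1" "distinct vs" "distinct es"
    "set vs \<subseteq> C" "set es \<subseteq> F"
    "\<forall>i < length es. inc (es ! i) = {vs ! i, vs ! ((i + 1) mod length es)}"
    using assms(1) unfolding has_cycle_def by blast
  have "es \<noteq> []" using c(2) by auto
  have "vs ! i \<in> component V F' inc (vs ! 0)" if "i < length es" for i
  proof -
    have "reach (F - {es ! 0}) inc (vs ! i) (vs ! 0)"
      using cycle_reach[OF c(1,4,6,7) \<open>es \<noteq> []\<close> that] .
    then have "reach F' inc (vs ! 0) (vs ! i)"
      using reach_mono[OF reach_sym] assms(2) by (meson Diff_subset subset_trans)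
    moreover have "vs ! i \<in> V" using c(1,5) assms(3) that by (metis nth_mem subsetD)
    ultimately show ?thesis by (simp add: component_def)
  qed
  then have "set vs \<subseteq> component V F' inc (vs ! 0)" using c(1) by (auto simp: in_set_conv_nth)
  then have "has_cycle (component V F' inc (vs ! 0)) F' inc"
    unfolding has_cycle_def using c assms(2) by blast
  moreover have "vs ! 0 \<in> C" using c(1,2,5) by (metis less_le_trans nth_mem subsetD zero_less_one)
  ultimately show ?thesis by blast
qed

text \<open>A set spanning at least as many edges as vertices contains a cycle. If both sides do,
  the edges between them separate two cycles.\<close>

lemma dense_sides_crossing:
  assumes mg: "multigraph V E inc" and cyc: "cyclically_k_edge_connected k V E inc"
    and C: "C \<subseteq> V" "C \<noteq> {}" "V - C \<noteq> {}"
    and dense: "card C \<le> card (induced_edges E inc C)"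
      "card (V - C) \<le> card (induced_edges E inc (V - C))"
  shows "k \<le> card (crossing E inc C)"
proof (rule ccontr)
  assume small: "\<not> ?thesis"
  let ?B = "crossing E inc C"
  have fin: "finite V" "finite E" using mg by (auto simp: multigraph_def)
  have cyc_in: "has_cycle Y (induced_edges E inc Y) inc"
    if "Y \<subseteq> V" "Y \<noteq> {}" "card Y \<le> card (induced_edges E inc Y)" for Y
    using that fin mg
    by (intro card_ge_imp_cycle) (auto simp: induced_edges_def multigraph_def intro: finite_subset)
  have "induced_edges E inc C \<subseteq> E - ?B" "induced_edges E inc (V - C) \<subseteq> E - ?B"
    using multigraph_inc_ne[OF mg] by (auto simp: induced_edges_def crossing_def)
  then obtain x y where x: "x \<in> C" "has_cycle (component V (E - ?B) inc x) (E - ?B) inc"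
    and y: "y \<in> V - C" "has_cycle (component V (E - ?B) inc y) (E - ?B) inc"
    using has_cycle_component[OF cyc_in] C dense by (metis Diff_subset)
  have stay: "z \<in> C" if "reach (E - ?B) inc x z" for z
    using reach_stays[OF that x(1)] by (auto simp: crossing_def)
  then have nreach: "\<not> reach (E - ?B) inc x y" using y(1) by blast
  have "y \<in> component V (E - ?B) inc y" using y(1) by (simp add: component_def reach.refl)
  then have "component V (E - ?B) inc x \<noteq> component V (E - ?B) inc y"
    using nreach by (auto simp: component_def)
  moreover have "\<not> connected_on V (E - ?B) inc"
    using nreach x(1) y(1) C(1) by (auto simp: connected_on_def)
  moreover have "?B \<subseteq> E" by (auto simp: crossing_def)
  ultimately have "cycle_separating V E inc ?B"
    unfolding cycle_separating_def using x y C(1) by blast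
  then show False
    using cyc small \<open>?B \<subseteq> E\<close> unfolding cyclically_k_edge_connected_def by auto
qed

text \<open>The hypothesis lets the total weight exceed \<open>card (E - D)\<close> by 2, but
  equality is ruled out by the parity of \<open>card E + card X\<close>.\<close>

lemma nebesky_by_parity:
  assumes mg: "multigraph X E inc" and odd: "odd (card E + card X)"
    and le: "\<And>P D. edge_partition inc X E P D \<Longrightarrow>
      (\<Sum>C\<in>P. weight inc D C) + card D \<le> card E + 2"
  shows "nebesky inc X E"
  unfolding nebesky_def
proof (intro allI impI)
  fix P D assume ep: "edge_partition inc X E P D"
  then have "D \<subseteq> E" by (simp add: edge_partition_def)
  then have "card (E - D) + card D = card E"
    using mg by (metis card_Diff_subset card_mono finite_subset le_add_diff_inverse2 multigraph_def)
  moreover have "even (\<Sum>C\<in>P. weight inc D C) \<longleftrightarrow> even (card D + card X)"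
    using even_sum_weight_iff[OF mg ep] .
  ultimately have "(\<Sum>C\<in>P. weight inc D C) \<noteq> card (E - D) + 2"
    using odd by (metis even_add even_numeral)
  then show "(\<Sum>C\<in>P. weight inc D C) \<le> card (E - D) + 1"
    using le[OF ep] \<open>card (E - D) + card D = card E\<close> by linarith
qed

section \<open>From a paired cotree to an induced tree\<close>

text \<open>The last equation counts the edges inside \<open>X\<close> as tree edges plus two cotree
  edges per deleted vertex; it fixes the size of the deleted set.\<close>

lemma induced_tree_of_paired_cotree:
  assumes cub: "cubic V E inc" and X: "X \<subseteq> V" "X \<noteq> {}"
    and paired: "paired_cotree inc X (induced_edges E inc X) {}"
  obtains A where "A \<subseteq> X" "is_tree A (induced_edges E inc A) inc"
    "card (induced_edges E inc A) + 1 = card A"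
    "2 * card (X - A) + card X = card (induced_edges E inc X) + 1"
proof -
  let ?E = "induced_edges E inc X"
  have mg: "multigraph V E inc" using cub by (simp add: cubic_def)
  have fin: "finite V" "finite E" "finite X" "finite ?E"
    using mg X(1) by (auto simp: multigraph_def induced_edges_def intro: finite_subset)
  obtain T \<phi> where T: "T \<subseteq> ?E" "connected_on X T inc" "card T + 1 = card X"
    and \<phi>: "\<forall>e\<in>?E - T. \<phi> e \<in> inc e \<inter> X" and ev: "\<forall>v. even (card {e \<in> ?E - T. \<phi> e = v})"
    using paired unfolding paired_cotree_def by auto
  define J where "J = \<phi> ` (?E - T)"
  have JX: "J \<subseteq> X" using \<phi> by (auto simp: J_def)
  have finJ: "finite J" using fin(4) by (simp add: J_def)
  have finT: "finite T" using T(1) fin(4) by (rule finite_subset)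
  \<comment> \<open>A vertex of \<open>J\<close> carries a positive even number of cotree edges;
    degree 3 permits only two, beside at most one tree edge.\<close>
  have fibre: "card {e \<in> ?E - T. \<phi> e = v} = 2 \<and> card {e \<in> T. v \<in> inc e} \<le> 1" if v: "v \<in> J" for v
  proof -
    let ?F = "{e \<in> ?E - T. \<phi> e = v}" and ?T = "{e \<in> T. v \<in> inc e}"
    have "?F \<noteq> {}" using v by (auto simp: J_def)
    then have "card ?F \<noteq> 0" using fin(4) by simp
    moreover have "even (card ?F)" using ev by blast
    moreover have "k \<ge> 2" if "k \<noteq> 0" "even k" for k :: nat using that by presburger
    ultimately have "card ?F \<ge> 2" by blast
    have "card {e \<in> E. v \<in> inc e} \<le>
        card ({e \<in> E. v \<in> inc e \<and> card (inc e) = 2} \<union> {e \<in> E. inc e = {v}})"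
      using fin(2) mg by (intro card_mono) (auto simp: multigraph_def card_1_singleton_iff)
    also have "\<dots> \<le> card {e \<in> E. v \<in> inc e \<and> card (inc e) = 2} + card {e \<in> E. inc e = {v}}"
      by (rule card_Un_le)
    also have "\<dots> \<le> degree E inc v" by (simp add: degree_def)
    also have "\<dots> = 3" using cub v JX X(1) by (auto simp: cubic_def)
    finally have "card {e \<in> E. v \<in> inc e} \<le> 3" .
    moreover have "card (?F \<union> ?T) \<le> card {e \<in> E. v \<in> inc e}"
      using fin(2) T(1) \<phi> by (intro card_mono) (auto simp: induced_edges_def)
    moreover have "card (?F \<union> ?T) = card ?F + card ?T"
      using fin(4) finT by (intro card_Un_disjoint) auto
    ultimately have "card ?F + card ?T \<le> 3" by linarith
    moreover have "k = 2 \<and> l \<le> 1" if "k + l \<le> 3" "k \<ge> 2" "even k" for k l :: nat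
      using that by presburger
    ultimately show ?thesis using \<open>card ?F \<ge> 2\<close> \<open>even (card ?F)\<close> by blast
  qed
  have "card (?E - T) = (\<Sum>v\<in>J. card {e \<in> ?E - T. \<phi> e = v})"
  proof -
    have "{e \<in> ?E - T. \<phi> e \<in> J} = ?E - T" by (auto simp: J_def)
    then show ?thesis using sum_card_fibres[OF finJ, of "?E - T" \<phi>] fin(4) by simp
  qed
  also have "\<dots> = 2 * card J" using fibre by simp
  finally have "2 * card J + card T = card ?E"
    using T(1) fin(4) finT by (metis card_Diff_subset card_mono le_add_diff_inverse2)
  then have count: "2 * card J + card X = card ?E + 1" using T(3) by simp
  \<comment> \<open>If all vertices were deleted, \<open>X\<close> would span
    \<open>3 * card X - 1\<close> edges, more than degree 3 permits.\<close>
  have "J \<noteq> X"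
  proof
    assume "J = X"
    then have "3 * card X = card ?E + 1" using count by simp
    moreover have "3 * card X \<ge> 2 * card ?E" using cubic_card[OF cub X(1)] by simp
    moreover have "card X \<noteq> 0" using X(2) fin(3) by simp
    ultimately show False by linarith
  qed
  then have "J \<subset> X" using JX by blast
  have sub: "inc e \<subseteq> X" if "e \<in> T" for e using T(1) that by (auto simp: induced_edges_def)
  have tree: "connected_on (X - J) (induced_edges T inc (X - J)) inc"
    "card (induced_edges T inc (X - J)) + 1 = card (X - J)"
    using tree_remove_leaves[OF finJ \<open>J \<subset> X\<close> fin(3) finT T(2) sub T(3)] fibre by auto
  \<comment> \<open>Every cotree edge has an end in \<open>J\<close>, so only tree edges
    survive.\<close>
  have eq: "induced_edges E inc (X - J) = induced_edges T inc (X - J)"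
  proof
    show "induced_edges E inc (X - J) \<subseteq> induced_edges T inc (X - J)"
    proof
      fix e assume e: "e \<in> induced_edges E inc (X - J)"
      then have "e \<in> ?E" by (auto simp: induced_edges_def)
      moreover have "e \<notin> ?E - T"
      proof
        assume "e \<in> ?E - T"
        then have "\<phi> e \<in> inc e" "\<phi> e \<in> J" using \<phi> by (auto simp: J_def)
        then show False using e by (auto simp: induced_edges_def)
      qed
      ultimately show "e \<in> induced_edges T inc (X - J)" using e by (auto simp: induced_edges_def)
    qed
    show "induced_edges T inc (X - J) \<subseteq> induced_edges E inc (X - J)"
      using T(1) by (auto simp: induced_edges_def)
  qed
  show ?thesis
  proof (rule that[of "X - J"])
    show "is_tree (X - J) (induced_edges E inc (X - J)) inc"
      unfolding is_tree_def eq
    proof (intro conjI tree(1) tree_card_acyclic)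
      show "finite (X - J)" using fin(3) by simp
      show "finite (induced_edges T inc (X - J))" using finT by (simp add: induced_edges_def)
    qed (use tree in \<open>auto simp: induced_edges_def\<close>)
    show "card (induced_edges E inc (X - J)) + 1 = card (X - J)" using tree(2) eq by simp
    have "X - (X - J) = J" using JX by blast
    then show "2 * card (X - (X - J)) + card X = card ?E + 1" using count by simp
  qed auto
qed

text \<open>By degrees, the tree on \<open>A\<close> sends \<open>card A + 2\<close> edges to its
  complement; the degree count there then gives the identity.\<close>

lemma cubic_tree_compl_count:
  assumes cub: "cubic V E inc" and "A \<subseteq> V" and "card (induced_edges E inc A) + 1 = card A"
  shows "card V + 2 + 2 * card (induced_edges E inc (V - A)) = 4 * card (V - A)"
proof -
  have mg: "multigraph V E inc" using cub by (simp add: cubic_def)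
  then have "finite V" by (simp add: multigraph_def)
  then have "card (V - A) + card A = card V"
    using assms(2) by (metis card_Diff_subset card_mono finite_subset le_add_diff_inverse2)
  moreover have "3 * card A = 2 * card (induced_edges E inc A) + card (crossing E inc A)"
    using cubic_card[OF cub assms(2)] .
  moreover have "3 * card (V - A) = 2 * card (induced_edges E inc (V - A)) + card (crossing E inc A)"
    using cubic_card[OF cub, of "V - A"] crossing_compl[OF mg assms(2)] by simp
  ultimately show ?thesis using assms(3) by linarith
qed

section \<open>Nebesky's condition in cyclically 4-edge-connected cubic graphs\<close>

locale cyclic4_cubic =
  fixes V :: "'a set" and E :: "'e set" and inc :: "'e \<Rightarrow> 'a set"
  assumes cub: "cubic V E inc" and cyc: "cyclically_k_edge_connected 4 V E inc"
begin

lemma mg: "multigraph V E inc" using cub by (simp add: cubic_def)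

lemma fin: "finite V" "finite E" using mg by (auto simp: multigraph_def)

lemma nonempty: "V \<noteq> {}"
  using cyc by (auto simp: cyclically_k_edge_connected_def connected_on_def)

lemma card_edges: "2 * card E = 3 * card V"
proof -
  have "induced_edges E inc V = E" "crossing E inc V = {}"
    using mg by (auto simp: induced_edges_def crossing_def multigraph_def)
  then show ?thesis using cubic_card[OF cub, of V] by simp
qed

text \<open>At least \<open>min 4 (card (V - C) + 2)\<close> edges leave \<open>C\<close>. If the
  other side is dense too, cyclic connectivity gives 4; otherwise it spans fewer edges than
  vertices, and its degree count gives \<open>card (V - C) + 2\<close>.\<close>

lemma dense_excess:
  assumes C: "C \<subseteq> V" "C \<noteq> {}" "V - C \<noteq> {}" and dense: "card C \<le> card (induced_edges E inc C)"
  shows "min 4 (card (V - C) + 2) + 2 * card (induced_edges E inc C) \<le> 3 * card C"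
proof (cases "card (V - C) \<le> card (induced_edges E inc (V - C))")
  case True
  then show ?thesis
    using dense_sides_crossing[OF mg cyc C dense] cubic_card[OF cub C(1)] by simp
next
  case False
  have "3 * card (V - C) = 2 * card (induced_edges E inc (V - C)) + card (crossing E inc C)"
    using cubic_card[OF cub, of "V - C"] crossing_compl[OF mg C(1)] by simp
  then have "card (V - C) + 2 \<le> card (crossing E inc C)" using False by linarith
  then show ?thesis using cubic_card[OF cub C(1)] by linarith
qed

text \<open>A loop leaves at most one further edge at \<open>x\<close>, while
  \<open>dense_excess\<close> demands at least three.\<close>

lemma no_loop:
  assumes "x \<in> V" "V \<noteq> {x}"
  shows "induced_edges E inc {x} = {}"
proof (rule ccontr)
  assume "induced_edges E inc {x} \<noteq> {}"
  then have "card (induced_edges E inc {x}) \<ge> 1"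
    using fin(2) by (simp add: Suc_le_eq card_gt_0_iff induced_edges_def)
  moreover have "V - {x} \<noteq> {}" using assms by blast
  moreover have "card (V - {x}) \<ge> 1"
    using fin(1) \<open>V - {x} \<noteq> {}\<close> by (simp add: Suc_le_eq card_gt_0_iff)
  ultimately show False using dense_excess[of "{x}"] assms(1) by simp
qed

text \<open>A dense part loses at least 4 edge ends to its cut, which pays for weight 2. A part with
  one edge fewer than vertices has weight 1, and with still fewer edges the missing ones
  pay.\<close>

lemma part_bound:
  assumes C: "C \<subseteq> V" "C \<noteq> {}" and "D \<subseteq> E"
    and "card (V - C) \<ge> 2 \<or> induced_edges E inc C = {}"
  shows "2 * weight inc D C + 2 * card (induced_edges D inc C) \<le> 3 * card C"
proof (cases "card C \<le> card (induced_edges D inc C)")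
  case True
  have le: "card (induced_edges D inc C) \<le> card (induced_edges E inc C)"
    using assms(3) fin(2) by (intro card_mono) (auto simp: induced_edges_def)
  have "card C \<noteq> 0" using C fin(1) by (simp add: finite_subset)
  then have "induced_edges E inc C \<noteq> {}" using True le by auto
  then have two: "card (V - C) \<ge> 2" using assms(4) by blast
  then have "V - C \<noteq> {}" by (metis card.empty not_numeral_le_zero)
  then have "4 + 2 * card (induced_edges E inc C) \<le> 3 * card C"
    using dense_excess[OF C] True le two by simp
  then show ?thesis using le by (simp add: weight_def)
next
  case False
  moreover have "2 * (if even (d + c) then 2 else 1) + 2 * d \<le> 3 * c" if "d < c" for d c :: nat
    using that by presburger
  ultimately show ?thesis by (simp add: weight_def)
qed

text \<open>Summing over \<open>Q\<close> instead of \<open>P\<close> allows an exceptional part to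
  be left out.\<close>

lemma sum_part_bound:
  assumes ep: "edge_partition inc X F P D" and sub: "X \<subseteq> V" "F \<subseteq> E"
    and Q: "Q \<subseteq> P"
    and bound: "\<And>C. C \<in> Q \<Longrightarrow> card (V - C) \<ge> 2 \<or> induced_edges E inc C = {}"
  shows "2 * (\<Sum>C\<in>Q. weight inc D C) + 2 * (\<Sum>C\<in>Q. card (induced_edges D inc C)) \<le> 3 * (\<Sum>C\<in>Q. card C)"
proof -
  have parts: "partition_on X P" and D: "D \<subseteq> E"
    using ep sub(2) by (auto simp: edge_partition_def)
  have "(\<Sum>C\<in>Q. 2 * weight inc D C + 2 * card (induced_edges D inc C)) \<le> (\<Sum>C\<in>Q. 3 * card C)"
  proof (rule sum_mono)
    fix C assume C: "C \<in> Q"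
    then have "C \<subseteq> V" "C \<noteq> {}" using parts Q sub(1) by (auto simp: partition_on_def)
    then show "2 * weight inc D C + 2 * card (induced_edges D inc C) \<le> 3 * card C"
      using part_bound D bound[OF C] by blast
  qed
  then show ?thesis by (simp add: sum.distrib sum_distrib_left)
qed

lemma nebesky_whole:
  assumes n: "card V mod 4 = 2"
  shows "nebesky inc V E"
proof (rule nebesky_by_parity[OF mg])
  \<comment> \<open>For \<open>card V = 4 * k + 2\<close> the sum is
    \<open>10 * k + 5\<close>.\<close>
  show "odd (card E + card V)" using card_edges n by presburger
  fix P D assume ep: "edge_partition inc V E P D"
  have parts: "partition_on V P" and D: "D \<subseteq> E" using ep by (auto simp: edge_partition_def)
  have finP: "finite P" using partition_on_finite[OF fin(1) parts] .
  have sums: "(\<Sum>C\<in>P. card (induced_edges D inc C)) = card D" "(\<Sum>C\<in>P. card C) = card V"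
    using sum_card_induced[OF mg ep] sum_card_parts[OF fin(1) parts] by auto
  have "2 * (\<Sum>C\<in>P. weight inc D C) + 2 * card D \<le> 3 * card V + 4"
  \<comment> \<open>The harmless exception is a part missing at most one vertex: fewer than four
    edges may leave it, but its doubled weight costs at most the extra 4 on the right.\<close>
  proof (cases "\<exists>C\<in>P. card (V - C) \<le> 1")
    case False
    then show ?thesis
      using sum_part_bound[OF ep order_refl order_refl order_refl] sums by fastforce
  next
    case True
    then obtain C where C: "C \<in> P" "card (V - C) \<le> 1" by blast
    have CV: "C \<subseteq> V" "C \<noteq> {}" using parts C(1) by (auto simp: partition_on_def)
    \<comment> \<open>At most one vertex lies outside \<open>C\<close>, and it has no loop, so
      \<open>part_bound\<close> still applies to it.\<close>
    have "induced_edges E inc B = {}" if B: "B \<in> P - {C}" for B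
    proof -
      have BV: "B \<subseteq> V - C" "B \<noteq> {}"
        using parts B C(1) by (auto simp: partition_on_def disjoint_def)
      then have "card B \<le> 1" using C(2) fin(1) card_mono[of "V - C" B] by simp
      moreover have "card B \<noteq> 0" using BV fin(1) by (auto dest: finite_subset)
      ultimately have "card B = 1" by simp
      then obtain x where x: "B = {x}" by (rule card_1_singletonE)
      then have "x \<in> V" "V \<noteq> {x}" using BV CV by auto
      then show ?thesis using no_loop x by simp
    qed
    then have "2 * (\<Sum>C\<in>P - {C}. weight inc D C) + 2 * (\<Sum>C\<in>P - {C}. card (induced_edges D inc C))
        \<le> 3 * (\<Sum>C\<in>P - {C}. card C)"
      using sum_part_bound[OF ep order_refl order_refl, of "P - {C}"] by blast
    moreover have "2 * card (induced_edges D inc C) \<le> 3 * card C"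
    proof -
      have "card (induced_edges D inc C) \<le> card (induced_edges E inc C)"
        using D fin(2) by (intro card_mono) (auto simp: induced_edges_def)
      then show ?thesis using cubic_card[OF cub CV(1)] by linarith
    qed
    moreover have "weight inc D C \<le> 2" by (simp add: weight_def)
    ultimately show ?thesis
      using sums sum.remove[OF finP C(1), of "weight inc D"] sum.remove[OF finP C(1), of card]
        sum.remove[OF finP C(1), of "\<lambda>C. card (induced_edges D inc C)"]
      by linarith
  qed
  then show "(\<Sum>C\<in>P. weight inc D C) + card D \<le> card E + 2" using card_edges by linarith
qed

text \<open>Two adjacent vertices span a single edge and four edges leave them, so 5 edges
  disappear. Every part of the remaining graph misses both vertices, so \<open>part_bound\<close>
  holds without exception.\<close>

lemma adjacent_pair_removed:
  assumes n: "card V mod 4 = 0"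
  obtains X where "X \<subseteq> V" "card (V - X) = 2" "X \<noteq> {}"
    "2 * card (induced_edges E inc X) + 10 = 3 * card V" "nebesky inc X (induced_edges E inc X)"
proof -
  have "card V \<noteq> 0" using nonempty fin(1) by simp
  with n have n4: "card V \<ge> 4" by presburger
  then have "card E > 0" using card_edges by linarith
  then obtain e where e: "e \<in> E" by (auto simp: card_gt_0_iff)
  have "card (inc e) = 2"
  proof (rule ccontr)
    assume "card (inc e) \<noteq> 2"
    then have "card (inc e) = 1" using mg e by (auto simp: multigraph_def)
    then obtain x where x: "inc e = {x}" by (rule card_1_singletonE)
    then have "x \<in> V" using mg e by (auto simp: multigraph_def)
    moreover have "V \<noteq> {x}" using n4 by auto
    ultimately have "induced_edges E inc {x} = {}" by (rule no_loop)
    then show False using e x by (auto simp: induced_edges_def)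
  qed
  define W where "W = inc e"
  have W: "W \<subseteq> V" "card W = 2" "W \<noteq> {}"
    using mg e \<open>card (inc e) = 2\<close> by (auto simp: W_def multigraph_def)
  have finW: "finite W" using W(1) fin(1) by (rule finite_subset)
  have cV: "card (V - W) + 2 = card V"
    using W card_Diff_subset[OF finW W(1)] n4 by simp
  have VW: "V - W \<noteq> {}"
  proof
    assume "V - W = {}"
    then have "card (V - W) = 0" by (simp only: card.empty)
    with cV n4 show False by linarith
  qed
  have "e \<in> induced_edges E inc W" using e by (simp add: W_def induced_edges_def)
  then have "card (induced_edges E inc W) \<ge> 1"
    using fin(2) by (auto simp: Suc_le_eq card_gt_0_iff induced_edges_def)
  \<comment> \<open>Two edges inside \<open>W\<close> would make it dense, with at most two edges
    leaving where four are required.\<close>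
  moreover have "\<not> card (induced_edges E inc W) \<ge> 2"
  proof
    assume "card (induced_edges E inc W) \<ge> 2"
    moreover have "V - W \<noteq> {}" using VW .
    ultimately show False using dense_excess[OF W(1,3)] W(2) cV n4 by simp
  qed
  ultimately have "card (induced_edges E inc W) = 1" by simp
  then have cross: "card (crossing E inc W) = 4" using cubic_card[OF cub W(1)] W(2) by simp
  let ?X = "V - W" let ?F = "induced_edges E inc ?X"
  have edges: "2 * card ?F + 10 = 3 * card V"
    using cubic_card[OF cub, of ?X] crossing_compl[OF mg W(1)] cross cV by simp
  have mgX: "multigraph ?X ?F inc" using mg by (rule multigraph_induced) auto
  have "nebesky inc ?X ?F"
  proof (rule nebesky_by_parity[OF mgX])
    \<comment> \<open>For \<open>k = 4 * m\<close> the sum is \<open>10 * m - 7\<close>.\<close>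
    have parity: "odd (f + x)" if "2 * f + 10 = 3 * k" "x + 2 = k" "k mod 4 = 0" for f x k :: nat
      using that by presburger
    show "odd (card ?F + card ?X)" by (rule parity[OF edges cV n])
    fix P D assume ep: "edge_partition inc ?X ?F P D"
    have parts: "partition_on ?X P" using ep by (simp add: edge_partition_def)
    have "card (V - C) \<ge> 2" if "C \<in> P" for C
    proof -
      have "W \<subseteq> V - C" using that parts W(1) by (auto simp: partition_on_def)
      then show ?thesis using W(2) fin(1) card_mono[of "V - C" W] by simp
    qed
    then have "2 * (\<Sum>C\<in>P. weight inc D C) + 2 * (\<Sum>C\<in>P. card (induced_edges D inc C))
        \<le> 3 * (\<Sum>C\<in>P. card C)"
      by (intro sum_part_bound[OF ep]) (auto simp: induced_edges_def)
    moreover have "(\<Sum>C\<in>P. card (induced_edges D inc C)) = card D" "(\<Sum>C\<in>P. card C) = card ?X"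
      using sum_card_induced[OF mgX ep] sum_card_parts[OF _ parts] fin(1) by auto
    \<comment> \<open>Here \<open>3 * card ?X = 2 * card ?F + 4\<close>, exactly the excess that
      parity can absorb.\<close>
    ultimately show "(\<Sum>C\<in>P. weight inc D C) + card D \<le> card ?F + 2"
      using edges cV by linarith
  qed
  moreover have "V - ?X = W" using W(1) by blast
  ultimately show ?thesis using that[of ?X] edges W(2) VW by simp
qed

end

theorem theorem4:
  fixes V :: "'a set" and E :: "'e set" and inc :: "'e \<Rightarrow> 'a set" and n :: nat
  assumes "cubic V E inc"
    and "cyclically_k_edge_connected 4 V E inc"
    and "card V = n"
  shows "\<exists>A J. A \<union> J = V \<and> A \<inter> J = {} \<and>
           is_tree A (induced_edges E inc A) inc \<and>
           (independent E inc J \<or> near_independent E inc J) \<and>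
           (independent E inc J \<longleftrightarrow> n mod 4 = 2)"
proof -
  interpret cyclic4_cubic V E inc using assms by unfold_locales
  \<comment> \<open>The first equation ties the number of edges inside \<open>V - A\<close> to its
    size; the second computes that size from \<open>X\<close>.\<close>
  have tree: "\<exists>A. A \<subseteq> X \<and> is_tree A (induced_edges E inc A) inc \<and>
      card V + 2 + 2 * card (induced_edges E inc (V - A)) = 4 * card (V - A) \<and>
      2 * card (V - A) + card X = card (induced_edges E inc X) + 1 + 2 * card (V - X)"
    if X: "X \<subseteq> V" "X \<noteq> {}" and neb: "nebesky inc X (induced_edges E inc X)" for X
  proof -
    have "paired_cotree inc X (induced_edges E inc X) {}"
      using nebesky_imp_paired_cotree[OF multigraph_induced[OF mg X(1)] X(2) neb] .
    then obtain A where A: "A \<subseteq> X" "is_tree A (induced_edges E inc A) inc"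
      "card (induced_edges E inc A) + 1 = card A"
      "2 * card (X - A) + card X = card (induced_edges E inc X) + 1"
      using induced_tree_of_paired_cotree[OF cub X] by blast
    have "V - A = (V - X) \<union> (X - A)" using A(1) X(1) by blast
    then have "card (V - A) = card (V - X) + card (X - A)"
      using fin(1) X(1) card_Un_disjoint[of "V - X" "X - A"] by (auto intro: finite_subset)
    then show ?thesis using A cubic_tree_compl_count[OF cub _ A(3)] X(1) by auto
  qed
  have "even n" using card_edges assms(3) by presburger
  then have "n mod 4 = 2 \<or> n mod 4 = 0" by presburger
  then consider "n mod 4 = 2" | "n mod 4 = 0" by metis
  then obtain A where A: "A \<subseteq> V" "is_tree A (induced_edges E inc A) inc"
    "card (induced_edges E inc (V - A)) = (if n mod 4 = 2 then 0 else 1)"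
  proof cases
    case 1
    have "induced_edges E inc V = E" using mg by (auto simp: induced_edges_def multigraph_def)
    with tree[of V] nonempty nebesky_whole 1 assms(3) obtain A where
      A: "A \<subseteq> V" "is_tree A (induced_edges E inc A) inc"
      "card V + 2 + 2 * card (induced_edges E inc (V - A)) = 4 * card (V - A)"
      "2 * card (V - A) + card V = card E + 1"
      by auto
    \<comment> \<open>With \<open>2 * card E = 3 * card V\<close> the size equation becomes
      \<open>4 * card (V - A) = card V + 2\<close>.\<close>
    then have "card (induced_edges E inc (V - A)) = 0" using card_edges by linarith
    with that[of A] A 1 show ?thesis by simp
  next
    case 2
    then have "card V mod 4 = 0" using assms(3) by simp
    then obtain X where X: "X \<subseteq> V" "card (V - X) = 2" "X \<noteq> {}"
      "2 * card (induced_edges E inc X) + 10 = 3 * card V" "nebesky inc X (induced_edges E inc X)"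
      by (rule adjacent_pair_removed)
    from tree[OF X(1,3,5)] obtain A where
      A: "A \<subseteq> X" "is_tree A (induced_edges E inc A) inc"
      "card V + 2 + 2 * card (induced_edges E inc (V - A)) = 4 * card (V - A)"
      "2 * card (V - A) + card X = card (induced_edges E inc X) + 1 + 2 * card (V - X)"
      by blast
    have "card X + 2 = card V"
      using X(1,2) fin(1) by (metis card_Diff_subset card_mono finite_subset le_add_diff_inverse)
    \<comment> \<open>The removed pair shifts the size equation to
      \<open>4 * card (V - A) = card V + 4\<close>, leaving exactly one edge.\<close>
    then have "card (induced_edges E inc (V - A)) = 1" using A X(2,4) by linarith
    with that[of A] A X(1) 2 show ?thesis by auto
  qed
  have "finite (induced_edges E inc (V - A))" using fin(2) by (simp add: induced_edges_def)
  then have "(independent E inc (V - A) \<or> near_independent E inc (V - A)) \<and>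
      (independent E inc (V - A) \<longleftrightarrow> n mod 4 = 2)"
    using A(3) by (auto simp: independent_def near_independent_def)
  then show ?thesis using A(1,2) by (intro exI[of _ A] exI[of _ "V - A"]) auto
qed

end
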